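(* Let $A\in\mathbb{R}^{m\times n}$, let $\epsilon>0$, and set $\tau=\frac{\epsilon/4}{\log m+\log n}$. Run PU or OMWU (defined in the context) on the entropy-regularized matrix game with parameter $\tau$, started from the uniform policies, with constant learning rate $\eta$ satisfying $0<\eta\le\frac{1}{\tau+2\|A\|_\infty}$ for PU, or $0<\eta\le\min\{\frac{1}{2\tau+2\|A\|_\infty},\frac{1}{4\|A\|_\infty}\}$ for OMWU. Then after $T=\widetilde{O}\left(\frac{1}{\eta\epsilon}\right)$ iterations, which is no more than $\widetilde{O}\left(\frac{\|A\|_\infty}{\epsilon}\right)$ iterations with optimized learning rates, the last iterate $\bar\zeta^{(T)}=(\bar\mu^{(T)},\bar\nu^{(T)})$ satisfies $\mathsf{DualGap}_\tau(\bar\zeta^{(T)})\le\epsilon/2$, and consequently it is an $\epsilon$-Nash equilibrium of the unregularized matrix game, i.e. $$\mathsf{DualGap}(\bar\zeta^{(T)})=\max_{\mu'\in\Delta(\mathcal{A})}\mu'^\top A\bar\nu^{(T)}-\min_{\nu'\in\Delta(\mathcal{B})}\bar\mu^{(T)\top}A\nu'\le\epsilon.$$ The Nash equilibrium of the unregularized game is not required to be unique.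
   Context: $\mathcal{A}=\{1,\dots,m\}$, $\mathcal{B}=\{1,\dots,n\}$, and $\Delta(\mathcal{A}),\Delta(\mathcal{B})$ are the probability simplices. $\|A\|_\infty=\max_{i,j}|A_{i,j}|$. The unregularized matrix game is $\max_{\mu\in\Delta(\mathcal{A})}\min_{\nu\in\Delta(\mathcal{B})}\mu^\top A\nu$; its entropy-regularized version replaces the objective by $f_\tau(\mu,\nu)=\mu^\top A\nu+\tau\mathcal{H}(\mu)-\tau\mathcal{H}(\nu)$ with $\mathcal{H}(\pi)=-\sum_i\pi_i\log\pi_i$. For $\zeta=(\mu,\nu)$, $\mathsf{DualGap}_\tau(\zeta)=\max_{\mu'\in\Delta(\mathcal{A})}f_\tau(\mu',\nu)-\min_{\nu'\in\Delta(\mathcal{B})}f_\tau(\mu,\nu')$. The notation $\widetilde{O}(\cdot)$ hides logarithmic dependencies. PU method: given $(\mu^{(0)},\nu^{(0)})$, for $t=0,1,2,\dots$ (each line normalized to a probability vector) $$\bar\mu^{(t+1)}(a)\propto\mu^{(t)}(a)^{1-\eta\tau}\exp(\eta[A\nu^{(t)}]_a),\qquad\bar\nu^{(t+1)}(b)\propto\nu^{(t)}(b)^{1-\eta\tau}\exp(-\eta[A^\top\mu^{(t)}]_b),$$ $$\mu^{(t+1)}(a)\propto\mu^{(t)}(a)^{1-\eta\tau}\exp(\eta[A\bar\nu^{(t+1)}]_a),\qquad\nu^{(t+1)}(b)\propto\nu^{(t)}(b)^{1-\eta\tau}\exp(-\eta[A^\top\bar\mu^{(t+1)}]_b).$$ OMWU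 method: initialized with $\bar\mu^{(0)}=\mu^{(0)}$, $\bar\nu^{(0)}=\nu^{(0)}$; for $t=0,1,2,\dots$ $$\bar\mu^{(t+1)}(a)\propto\mu^{(t)}(a)^{1-\eta\tau}\exp(\eta[A\bar\nu^{(t)}]_a),\qquad\bar\nu^{(t+1)}(b)\propto\nu^{(t)}(b)^{1-\eta\tau}\exp(-\eta[A^\top\bar\mu^{(t)}]_b),$$ and $\mu^{(t+1)},\nu^{(t+1)}$ are given by the same two formulas as in PU. *)

theory Defs
  imports Complex_Main "Jordan_Normal_Form.Matrix"
begin

definition max_norm :: "real mat \<Rightarrow> real" where
  "max_norm A = Max (abs ` elements_mat A)"

definition prob_simplex :: "nat \<Rightarrow> real vec set" where
  "prob_simplex n = {p \<in> carrier_vec n. (\<forall>i<n. 0 \<le> p $ i) \<and> (\<Sum>i<n. p $ i) = 1}"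

definition uniform_policy :: "nat \<Rightarrow> real vec" where
  "uniform_policy n = vec n (\<lambda>_. 1 / real n)"

(* The convention 0 * log 0 = 0 is inherited from ln 0 = 0. *)
definition entropy :: "real vec \<Rightarrow> real" where
  "entropy p = - (\<Sum>i<dim_vec p. p $ i * ln (p $ i))"

definition payoff :: "real mat \<Rightarrow> real vec \<Rightarrow> real vec \<Rightarrow> real" where
  "payoff A \<mu> \<nu> = \<mu> \<bullet> (A *\<^sub>v \<nu>)"

definition reg_payoff :: "real mat \<Rightarrow> real \<Rightarrow> real vec \<Rightarrow> real vec \<Rightarrow> real" where
  "reg_payoff A \<tau> \<mu> \<nu> = payoff A \<mu> \<nu> + \<tau> * entropy \<mu> - \<tau> * entropy \<nu>"

(* The objectives are continuous on the compact simplices, so the suprema and infima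
   below are the maxima and minima. *)
definition dual_gap :: "real mat \<Rightarrow> real vec \<times> real vec \<Rightarrow> real" where
  "dual_gap A = (\<lambda>(\<mu>, \<nu>).
     (SUP \<mu>'\<in>prob_simplex (dim_row A). payoff A \<mu>' \<nu>)
   - (INF \<nu>'\<in>prob_simplex (dim_col A). payoff A \<mu> \<nu>'))"

definition reg_dual_gap :: "real mat \<Rightarrow> real \<Rightarrow> real vec \<times> real vec \<Rightarrow> real" where
  "reg_dual_gap A \<tau> = (\<lambda>(\<mu>, \<nu>).
     (SUP \<mu>'\<in>prob_simplex (dim_row A). reg_payoff A \<tau> \<mu>' \<nu>)
   - (INF \<nu>'\<in>prob_simplex (dim_col A). reg_payoff A \<tau> \<mu> \<nu>'))"

definition normalize_vec :: "real vec \<Rightarrow> real vec" where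
  "normalize_vec w = (1 / (\<Sum>i<dim_vec w. w $ i)) \<cdot>\<^sub>v w"

definition mw_update :: "real \<Rightarrow> real \<Rightarrow> real vec \<Rightarrow> real vec \<Rightarrow> real vec" where
  "mw_update \<eta> \<tau> p g =
     normalize_vec (vec (dim_vec p) (\<lambda>i. (p $ i) powr (1 - \<eta> * \<tau>) * exp (\<eta> * g $ i)))"

(* Update of the first policy pair against the gradients evaluated at the second pair. *)
definition policy_update ::
  "real mat \<Rightarrow> real \<Rightarrow> real \<Rightarrow> real vec \<times> real vec \<Rightarrow> real vec \<times> real vec \<Rightarrow> real vec \<times> real vec" where
  "policy_update A \<eta> \<tau> = (\<lambda>(\<mu>, \<nu>) (\<mu>', \<nu>').
     (mw_update \<eta> \<tau> \<mu> (A *\<^sub>v \<nu>'), mw_update \<eta> \<tau> \<nu> (- (transpose_mat A *\<^sub>v \<mu>'))))"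

definition initial_policies :: "real mat \<Rightarrow> real vec \<times> real vec" where
  "initial_policies A = (uniform_policy (dim_row A), uniform_policy (dim_col A))"

(* Both iterations carry the state (zeta, zeta_bar), where zeta = (mu, nu) and
   zeta_bar = (mu_bar, nu_bar).  PU does not use zeta_bar at time 0; it is set to
   zeta at time 0, as in OMWU. *)
primrec pu_iter ::
  "real mat \<Rightarrow> real \<Rightarrow> real \<Rightarrow> nat \<Rightarrow> (real vec \<times> real vec) \<times> (real vec \<times> real vec)" where
  "pu_iter A \<eta> \<tau> 0 = (initial_policies A, initial_policies A)"
| "pu_iter A \<eta> \<tau> (Suc t) =
     (let (\<zeta>, _) = pu_iter A \<eta> \<tau> t;
          \<zeta>_bar = policy_update A \<eta> \<tau> \<zeta> \<zeta>
      in (policy_update A \<eta> \<tau> \<zeta> \<zeta>_bar, \<zeta>_bar))"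

primrec omwu_iter ::
  "real mat \<Rightarrow> real \<Rightarrow> real \<Rightarrow> nat \<Rightarrow> (real vec \<times> real vec) \<times> (real vec \<times> real vec)" where
  "omwu_iter A \<eta> \<tau> 0 = (initial_policies A, initial_policies A)"
| "omwu_iter A \<eta> \<tau> (Suc t) =
     (let (\<zeta>, \<zeta>_old) = omwu_iter A \<eta> \<tau> t;
          \<zeta>_bar = policy_update A \<eta> \<tau> \<zeta> \<zeta>_old
      in (policy_update A \<eta> \<tau> \<zeta> \<zeta>_bar, \<zeta>_bar))"

definition pu_max_rate :: "real mat \<Rightarrow> real \<Rightarrow> real" where
  "pu_max_rate A \<tau> = 1 / (\<tau> + 2 * max_norm A)"

(* For A = 0 the bound 1 / (4 * max_norm A) reads as infinity, not as the HOL value 1 / 0 = 0. *)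
definition omwu_max_rate :: "real mat \<Rightarrow> real \<Rightarrow> real" where
  "omwu_max_rate A \<tau> =
     (if max_norm A = 0 then 1 / (2 * \<tau> + 2 * max_norm A)
      else min (1 / (2 * \<tau> + 2 * max_norm A)) (1 / (4 * max_norm A)))"

(* The bound hidden in a soft-O of x: constant times x times a power of a logarithm,
   where the logarithm may involve x and the sizes m, n of the two action sets. *)
definition soft_O_bound :: "real \<Rightarrow> nat \<Rightarrow> nat \<Rightarrow> nat \<Rightarrow> real \<Rightarrow> real" where
  "soft_O_bound C k m n x = C * x * (ln (2 + real m + real n + x)) ^ k"

end

theory Submission
  imports Defs "HOL-Analysis.Convex" "HOL-Analysis.Function_Topology" "HOL-Real_Asymp.Real_Asymp"
begin

text \<open>
  Let \<open>\<zeta>*\<close> be the equilibrium of the regularized game. Multiplicative updates are affine in the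
  logarithms of the policies, so testing the update equation against \<open>\<zeta>bar - \<zeta>*\<close> makes the bilinear
  payoff cancel and expresses \<open>KL(\<zeta>*, \<zeta>')\<close> as \<open>(1 - \<eta> \<tau>) KL(\<zeta>*, \<zeta>) - \<eta> \<tau> KL(\<zeta>bar, \<zeta>*)\<close> plus an
  extrapolation error, which Pinsker's inequality absorbs into the remaining negative divergences
  when \<open>\<eta>\<close> is small (for OMWU after adding a multiple of \<open>KL(\<zeta>, \<zeta>bar)\<close> to the potential). Hence
  \<open>KL(\<zeta>bar, \<zeta>*)\<close> decays geometrically, and it controls the duality gap.

  When the payoffs are small compared with \<open>\<epsilon>\<close>, the soft-O bound allows fewer than one iteration.
  There every iterate is good, because the log-ratios of all iterates started from the uniform
  policy stay below \<open>2 K / \<tau>\<close>.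
\<close>

subsection \<open>Relative entropy\<close>

text \<open>The gap is charged to the divergence with the factor \<tau> + K^2 / \<tau>, and the
  contraction is divided by \<eta> * \<tau>. Such polynomial losses in 1 / (\<eta> * \<tau>) cost
  only a logarithmic factor of iterations, because the decay is geometric. The value of \<tau> is
  such that dropping both entropy terms raises the gap by at most \<epsilon> / 4, which added to
  \<epsilon> / 2 stays below \<epsilon>. For m = n = 1 its formula divides by ln 1 + ln 1 = 0, so
  that game is treated separately. Up to logarithms 1 / (\<eta> * \<epsilon>) is bounded below,
  since \<eta> * \<tau> \<le> 1, but K / \<epsilon> can be arbitrarily small: this second bound is
  what forces the separate argument for small payoffs.\<close>

definition simplex_on :: "'a set \<Rightarrow> ('a \<Rightarrow> real) set" where
  "simplex_on I = {p. (\<forall>i\<in>I. 0 \<le> p i) \<and> sum p I = 1}"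

definition pos_simplex :: "'a set \<Rightarrow> ('a \<Rightarrow> real) set" where
  "pos_simplex I = {p. (\<forall>i\<in>I. 0 < p i) \<and> sum p I = 1}"

definition KL :: "'a set \<Rightarrow> ('a \<Rightarrow> real) \<Rightarrow> ('a \<Rightarrow> real) \<Rightarrow> real" where
  "KL I p q = (\<Sum>i\<in>I. p i * (ln (p i) - ln (q i)))"

definition l1 :: "'a set \<Rightarrow> ('a \<Rightarrow> real) \<Rightarrow> real" where
  "l1 I x = (\<Sum>i\<in>I. \<bar>x i\<bar>)"

lemma pos_simplex_subset: "p \<in> pos_simplex I \<Longrightarrow> p \<in> simplex_on I"
  by (auto simp: pos_simplex_def simplex_on_def intro: less_imp_le)

lemma l1_nonneg: "0 \<le> l1 I x"
  by (simp add: l1_def sum_nonneg)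

lemma l1_minus_commute: "l1 I (\<lambda>i. p i - q i) = l1 I (\<lambda>i. q i - p i)"
  by (simp add: l1_def abs_minus_commute)

lemma l1_simplex: "p \<in> simplex_on I \<Longrightarrow> l1 I p = 1"
  by (simp add: l1_def simplex_on_def)

text \<open>The function is the derivative of \<open>F\<close> in \<open>pinsker_scalar_1\<close>.
  Its own derivative is nonnegative exactly when \<open>27 * x \<le> (x + 2)^3\<close>, the
  inequality of arithmetic and geometric means for x, 1, 1. Hence \<open>F\<close> is
  convex.\<close>

lemma ln_minus_rational_has_derivative:
  fixes x :: real
  assumes "0 < x"
  shows "((\<lambda>x. ln x - 3/2 * ((x - 1) * (x + 5) / (x + 2)^2)) has_real_derivative
          (1 / x - 27 / (x + 2)^3)) (at x)"
  using assms
  apply (auto intro!: derivative_eq_intros)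
  apply (simp add: divide_simps)
  apply (simp add: algebra_simps eval_nat_numeral)
  done

lemma cube_ge:
  fixes x :: real
  assumes "0 < x"
  shows "27 * x \<le> (x + 2)^3"
proof -
  have "(x + 2)^3 - 27 * x = (x - 1)^2 * (x + 8)"
    by (simp add: power2_eq_square power3_eq_cube algebra_simps)
  moreover have "0 \<le> (x - 1)^2 * (x + 8)" using assms by simp
  ultimately show ?thesis by linarith
qed

lemma mono_ln_minus_rational:
  fixes x y :: real
  assumes "0 < x" "x \<le> y"
  shows "ln x - 3/2 * ((x - 1) * (x + 5) / (x + 2)^2) \<le> ln y - 3/2 * ((y - 1) * (y + 5) / (y + 2)^2)"
proof (rule DERIV_nonneg_imp_nondecreasing[OF assms(2)])
  fix z assume z: "x \<le> z" "z \<le> y"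
  then have "0 < z" using assms by simp
  moreover have "0 \<le> 1 / z - 27 / (z + 2)^3"
    using cube_ge[OF \<open>0 < z\<close>] \<open>0 < z\<close> by (simp add: field_simps)
  ultimately show "\<exists>d. ((\<lambda>x. ln x - 3/2 * ((x - 1) * (x + 5) / (x + 2)^2)) has_real_derivative d) (at z) \<and> 0 \<le> d"
    using ln_minus_rational_has_derivative by blast
qed

text \<open>\<open>F\<close> and its derivative vanish at 1, and the derivative is nondecreasing by
  \<open>mono_ln_minus_rational\<close>, so 1 is the minimum; the two cases are the two sides of
  1.\<close>

lemma pinsker_scalar_1:
  fixes x :: real
  assumes "0 < x"
  shows "3 * (x - 1)^2 / (2 * (x + 2)) \<le> x * ln x - x + 1"
proof -
  define F :: "real \<Rightarrow> real" where "F = (\<lambda>x. x * ln x - x + 1 - 3/2 * ((x - 1)^2 / (x + 2)))"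
  have der: "(F has_real_derivative (ln z - 3/2 * ((z - 1) * (z + 5) / (z + 2)^2))) (at z)" if "0 < z" for z
    unfolding F_def using that
    apply (auto intro!: derivative_eq_intros)
    apply (simp add: divide_simps)
    apply (simp add: algebra_simps eval_nat_numeral)
    done
  have F1: "F 1 = 0" by (simp add: F_def)
  have "0 \<le> F x"
  proof (cases "1 \<le> x")
    case True
    have "F 1 \<le> F x"
    proof (rule DERIV_nonneg_imp_nondecreasing[OF True])
      fix z :: real assume z: "1 \<le> z" "z \<le> x"
      have "0 \<le> ln z - 3/2 * ((z - 1) * (z + 5) / (z + 2)^2)"
        using mono_ln_minus_rational[of 1 z] z by simp
      then show "\<exists>d. (F has_real_derivative d) (at z) \<and> 0 \<le> d"
        using der[of z] z by (intro exI[of _ "ln z - 3/2 * ((z - 1) * (z + 5) / (z + 2)^2)"]) simp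
    qed
    then show ?thesis using F1 by simp
  next
    case False
    have "F x \<ge> F 1"
    proof (rule DERIV_nonpos_imp_nonincreasing[of x 1])
      show "x \<le> 1" using False by simp
    next
      fix z :: real assume z: "x \<le> z" "z \<le> 1"
      have "ln z - 3/2 * ((z - 1) * (z + 5) / (z + 2)^2) \<le> 0"
        using mono_ln_minus_rational[of z 1] z assms by simp
      then show "\<exists>d. (F has_real_derivative d) (at z) \<and> d \<le> 0"
        using der[of z] z assms by (intro exI[of _ "ln z - 3/2 * ((z - 1) * (z + 5) / (z + 2)^2)"]) simp
    qed
    then show ?thesis using F1 by simp
  qed
  moreover have "3/2 * ((x - 1)^2 / (x + 2)) = 3 * (x - 1)^2 / (2 * (x + 2))" by simp
  ultimately show ?thesis by (simp add: F_def)
qed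

text \<open>The homogeneous form of \<open>pinsker_scalar_1\<close> with x = p / q. The correction -
  p + q makes every summand nonnegative and vanishes on summing over two probability vectors, while
  the weight 2 * p + 4 * q is linear and sums to 6. Together they give the sharp constant of
  \<open>pinsker\<close> after Cauchy-Schwarz.\<close>

lemma pinsker_scalar:
  fixes p q :: real
  assumes "0 \<le> p" "0 < q"
  shows "3 * (p - q)^2 \<le> (2 * p + 4 * q) * (p * (ln p - ln q) - p + q)"
proof (cases "p = 0")
  case True
  then show ?thesis using assms by (simp add: power2_eq_square)
next
  case False
  then have p: "0 < p" using assms by simp
  define x where "x = p / q"
  have x: "0 < x" "p = x * q" using p assms by (auto simp: x_def)
  have l: "ln p - ln q = ln x" using p assms by (simp add: x_def ln_div)
  have "3 * (x - 1)^2 \<le> (x * ln x - x + 1) * (2 * (x + 2))"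
    using pinsker_scalar_1[OF x(1)] x(1) by (simp add: pos_divide_le_eq)
  then have "3 * (x - 1)^2 * q^2 \<le> (x * ln x - x + 1) * (2 * (x + 2)) * q^2"
    by (rule mult_right_mono) simp
  then show ?thesis unfolding l
    by (simp add: x(2) power2_eq_square algebra_simps)
qed

theorem pinsker:
  assumes "finite I" "p \<in> simplex_on I" "q \<in> pos_simplex I"
  shows "(l1 I (\<lambda>i. p i - q i))^2 \<le> 2 * KL I p q"
proof -
  have p: "\<And>i. i \<in> I \<Longrightarrow> 0 \<le> p i" "sum p I = 1" using assms(2) by (auto simp: simplex_on_def)
  have q: "\<And>i. i \<in> I \<Longrightarrow> 0 < q i" "sum q I = 1" using assms(3) by (auto simp: pos_simplex_def)
  define w where "w = (\<lambda>i. (2 * p i + 4 * q i) / 3)"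
  define h where "h = (\<lambda>i. p i * (ln (p i) - ln (q i)) - p i + q i)"
  have w: "0 < w i" if "i \<in> I" for i using p(1)[OF that] q(1)[OF that] by (simp add: w_def)
  have wh: "(p i - q i)^2 \<le> w i * h i" if "i \<in> I" for i
    using pinsker_scalar[OF p(1)[OF that] q(1)[OF that]] by (simp add: w_def h_def)
  have h: "0 \<le> h i" if "i \<in> I" for i
    using w[OF that] wh[OF that] zero_le_power2[of "p i - q i"]
    by (meson order_trans zero_le_mult_iff not_less_iff_gr_or_eq linorder_not_le)
  have "l1 I (\<lambda>i. p i - q i) \<le> (\<Sum>i\<in>I. sqrt (w i) * sqrt (h i))"
    unfolding l1_def
  proof (rule sum_mono)
    fix i assume "i \<in> I"
    then show "\<bar>p i - q i\<bar> \<le> sqrt (w i) * sqrt (h i)"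
      using wh[of i] by (metis real_sqrt_abs real_sqrt_le_iff real_sqrt_mult)
  qed
  then have "(l1 I (\<lambda>i. p i - q i))^2 \<le> (\<Sum>i\<in>I. sqrt (w i) * sqrt (h i))^2"
    by (rule power_mono) (rule l1_nonneg)
  also have "\<dots> \<le> (\<Sum>i\<in>I. (sqrt (w i))^2) * (\<Sum>i\<in>I. (sqrt (h i))^2)"
    by (rule Cauchy_Schwarz_ineq_sum)
  also have "(\<Sum>i\<in>I. (sqrt (w i))^2) = sum w I"
    using w by (intro sum.cong) (auto intro: less_imp_le)
  also have "(\<Sum>i\<in>I. (sqrt (h i))^2) = sum h I"
    using h by (intro sum.cong) auto
  also have "sum w I = 2"
    using p(2) q(2) by (simp add: w_def sum.distrib flip: sum_divide_distrib sum_distrib_left)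
  also have "sum h I = KL I p q"
    using p(2) q(2) by (simp add: h_def KL_def sum.distrib sum_subtractf)
  finally show ?thesis .
qed

lemma KL_nonneg:
  assumes "finite I" "p \<in> simplex_on I" "q \<in> pos_simplex I"
  shows "0 \<le> KL I p q"
  using pinsker[OF assms] zero_le_power2[of "l1 I (\<lambda>i. p i - q i)"] by linarith

lemma KL_nonpos_imp_eq:
  assumes "finite I" "p \<in> simplex_on I" "q \<in> pos_simplex I" "KL I p q \<le> 0" "i \<in> I"
  shows "p i = q i"
proof -
  have "(l1 I (\<lambda>i. p i - q i))^2 \<le> 0" using pinsker[OF assms(1-3)] assms(4) by linarith
  then have "(\<Sum>i\<in>I. \<bar>p i - q i\<bar>) = 0" by (simp add: l1_def)
  then show ?thesis using assms(1,5) by (simp add: sum_nonneg_eq_0_iff)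
qed

section \<open>Continuity and convexity of x ln x on the closed half-line\<close>

lemma continuous_on_mult_ln: "continuous_on {0..} (\<lambda>x::real. x * ln x)"
proof -
  have "continuous (at x within {0..}) (\<lambda>x::real. x * ln x)" if "x \<ge> 0" for x :: real
  proof (cases "x = 0")
    case True
    have "((\<lambda>x::real. x * ln x) \<longlongrightarrow> 0) (at_right 0)" by real_asymp
    moreover have "at (0::real) within {0..} = at_right 0"
      by (rule at_within_nhd[of _ UNIV]) auto
    ultimately show ?thesis using True by (simp add: continuous_within)
  next
    case False
    then show ?thesis using that by (auto intro!: continuous_intros)
  qed
  then show ?thesis by (simp add: continuous_on_eq_continuous_within)
qed

lemma mult_ln_tangent:
  fixes u z :: real
  assumes "0 \<le> u" "0 < z"
  shows "u * ln z + u - z \<le> u * ln u"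
proof (cases "u = 0")
  case False
  then have u: "0 < u" using assms by simp
  have "ln z - ln u \<le> z / u - 1"
    using ln_le_minus_one[of "z / u"] u assms by (simp add: ln_div)
  then have "u * (ln z - ln u) \<le> u * (z / u - 1)"
    using u by (intro mult_left_mono) auto
  then show ?thesis using u by (simp add: algebra_simps)
qed (use assms in simp)

text \<open>Both endpoints lie above the tangent at the mixture z, and the mixture of the two
  tangent values is z ln z. At z = 0 there is no tangent, but then x and y both vanish.\<close>

lemma mult_ln_convex:
  fixes x y s :: real
  assumes "0 \<le> x" "0 \<le> y" "0 < s" "s < 1"
  shows "((1 - s) * x + s * y) * ln ((1 - s) * x + s * y) \<le> (1 - s) * (x * ln x) + s * (y * ln y)"
proof -
  define z where "z = (1 - s) * x + s * y"
  have nn: "0 \<le> (1 - s) * x" "0 \<le> s * y" using assms by auto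
  show ?thesis
  proof (cases "z = 0")
    case True
    then have "(1 - s) * x = 0" "s * y = 0" using nn unfolding z_def by linarith+
    then have "x = 0" "y = 0" using assms by auto
    then show ?thesis by simp
  next
    case False
    then have z: "0 < z" using nn by (simp add: z_def)
    have "(1 - s) * (x * ln z + x - z) \<le> (1 - s) * (x * ln x)"
      using mult_ln_tangent[OF assms(1) z] assms by (intro mult_left_mono) auto
    moreover have "s * (y * ln z + y - z) \<le> s * (y * ln y)"
      using mult_ln_tangent[OF assms(2) z] assms by (intro mult_left_mono) auto
    moreover have "(1 - s) * (x * ln z + x - z) + s * (y * ln z + y - z) = z * ln z"
      by (simp add: z_def algebra_simps)
    ultimately show ?thesis unfolding z_def by linarith
  qed
qed

subsection \<open>Softmax and multiplicative updates\<close>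

definition softmax :: "'a set \<Rightarrow> ('a \<Rightarrow> real) \<Rightarrow> 'a \<Rightarrow> real" where
  "softmax I g i = exp (g i) / (\<Sum>k\<in>I. exp (g k))"

definition log_sum_exp :: "'a set \<Rightarrow> ('a \<Rightarrow> real) \<Rightarrow> real" where
  "log_sum_exp I g = ln (\<Sum>k\<in>I. exp (g k))"

lemma sum_exp_pos: "finite I \<Longrightarrow> I \<noteq> {} \<Longrightarrow> 0 < (\<Sum>k\<in>I. exp (g k :: real))"
  by (rule sum_pos) auto

lemma softmax_pos_simplex:
  assumes "finite I" "I \<noteq> {}"
  shows "softmax I g \<in> pos_simplex I"
  using sum_exp_pos[OF assms, of g]
  by (auto simp: pos_simplex_def softmax_def simp flip: sum_divide_distrib)

lemma ln_softmax:
  assumes "finite I" "I \<noteq> {}"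
  shows "ln (softmax I g i) = g i - log_sum_exp I g"
  using sum_exp_pos[OF assms, of g] by (simp add: softmax_def log_sum_exp_def ln_div)

text \<open>\<open>log_sum_exp\<close> is the convex conjugate of negative entropy, and the
  divergence from the softmax is exactly what a suboptimal \<open>p\<close> loses. In
  \<open>equilibrium_exists\<close> this gives both the value and the uniqueness of best
  responses.\<close>

lemma gibbs_variational:
  assumes "finite I" "I \<noteq> {}" "p \<in> simplex_on I"
  shows "log_sum_exp I g = (\<Sum>i\<in>I. p i * g i) - (\<Sum>i\<in>I. p i * ln (p i)) + KL I p (softmax I g)"
proof -
  have "KL I p (softmax I g) = (\<Sum>i\<in>I. p i * ln (p i)) - (\<Sum>i\<in>I. p i * g i) + (\<Sum>i\<in>I. p i) * log_sum_exp I g"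
    by (simp add: KL_def ln_softmax[OF assms(1,2)] sum_distrib_right flip: sum.distrib sum_subtractf)
      (simp add: algebra_simps)
  moreover have "(\<Sum>i\<in>I. p i) = 1" using assms(3) by (simp add: simplex_on_def)
  ultimately show ?thesis by simp
qed

text \<open>Policies are functions on the whole type; forcing the values outside \<open>I\<close> to
  0 places the simplex inside a product of compact sets, where Tychonoff's theorem applies.\<close>

lemma compact_supported_simplex:
  assumes "finite I"
  shows "compact {p \<in> simplex_on I. \<forall>i. i \<notin> I \<longrightarrow> p i = 0}"
proof -
  define B :: "'a \<Rightarrow> real set" where "B = (\<lambda>i. if i \<in> I then {0..1} else {0})"
  have "compactin (product_topology (\<lambda>_. euclidean) UNIV) (PiE UNIV B)"
    by (subst compactin_PiE) (auto simp: B_def)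
  then have "compact (PiE UNIV B)"
    by (simp add: euclidean_product_topology)
  moreover have "closed {p. sum p I = (1::real)}"
    by (intro closed_Collect_eq continuous_intros continuous_on_sum continuous_on_product_coordinates)
  ultimately have "compact (PiE UNIV B \<inter> {p. sum p I = 1})"
    by (rule compact_Int_closed)
  moreover have "PiE UNIV B \<inter> {p. sum p I = 1} = {p \<in> simplex_on I. \<forall>i. i \<notin> I \<longrightarrow> p i = 0}"
  proof -
    have "p i \<le> 1" if "p \<in> simplex_on I" "i \<in> I" for p i
      using that assms member_le_sum[of i I p] by (auto simp: simplex_on_def)
    then show ?thesis by (fastforce simp: B_def simplex_on_def PiE_def Pi_def split: if_splits)
  qed
  ultimately show ?thesis by simp
qed

text \<open>A relation up to an additive constant in the logarithms: the constant \<open>c\<close>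
  drops out whenever the equation is summed against a difference of two probability vectors.\<close>

definition mw_step :: "'a set \<Rightarrow> real \<Rightarrow> real \<Rightarrow> ('a \<Rightarrow> real) \<Rightarrow> ('a \<Rightarrow> real) \<Rightarrow> ('a \<Rightarrow> real) \<Rightarrow> bool" where
  "mw_step I \<eta> \<tau> p g q \<longleftrightarrow> q \<in> pos_simplex I \<and>
     (\<exists>c. \<forall>i\<in>I. ln (q i) = (1 - \<eta> * \<tau>) * ln (p i) + \<eta> * g i + c)"

text \<open>Here \<open>p'\<close> is the extrapolated policy driven by \<open>g'\<close>,
  \<open>q\<close> the actual next policy driven by \<open>g\<close>, and \<open>h\<close> the
  payoff vector at the equilibrium \<open>ps\<close>. After substituting the logarithms, the two
  sides differ pointwise only by constants times \<open>p' i - ps i\<close> and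
  \<open>p' i - q i\<close>, and these sum to 0.\<close>

lemma mw_step_three_point:
  assumes "mw_step I \<eta> \<tau> p g' p'" "mw_step I \<eta> \<tau> p g q" "ps \<in> pos_simplex I"
    and "\<forall>i\<in>I. \<tau> * ln (ps i) = h i + c"
  shows "KL I ps q = (1 - \<eta> * \<tau>) * (KL I ps p - KL I p' p) - \<eta> * \<tau> * KL I p' ps - KL I q p'
     + \<eta> * (\<Sum>i\<in>I. (g' i - g i) * (p' i - q i)) + \<eta> * (\<Sum>i\<in>I. (g i - h i) * (p' i - ps i))"
proof -
  obtain c1 c2 where c1: "\<And>i. i \<in> I \<Longrightarrow> ln (q i) = (1 - \<eta> * \<tau>) * ln (p i) + \<eta> * g i + c1"
    and c2: "\<And>i. i \<in> I \<Longrightarrow> ln (p' i) = (1 - \<eta> * \<tau>) * ln (p i) + \<eta> * g' i + c2"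
    using assms(1,2) unfolding mw_step_def by blast
  have sums: "sum q I = 1" "sum p' I = 1" "sum ps I = 1"
    using assms by (auto simp: mw_step_def pos_simplex_def)
  have *: "ps i * (ln (ps i) - ln (q i)) - (1 - \<eta> * \<tau>) * (ps i * (ln (ps i) - ln (p i)) - p' i * (ln (p' i) - ln (p i)))
     + \<eta> * \<tau> * (p' i * (ln (p' i) - ln (ps i))) + q i * (ln (q i) - ln (p' i))
     - \<eta> * ((g' i - g i) * (p' i - q i)) - \<eta> * ((g i - h i) * (p' i - ps i))
     = (c1 - \<eta> * c) * (p' i - ps i) + (c2 - c1) * (p' i - q i)" if "i \<in> I" for i
  proof -
    have h: "h i = \<tau> * ln (ps i) - c" using assms(4) that by simp
    show ?thesis unfolding c1[OF that] c2[OF that] h by (simp add: algebra_simps)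
  qed
  have "KL I ps q - (1 - \<eta> * \<tau>) * (KL I ps p - KL I p' p) + \<eta> * \<tau> * KL I p' ps + KL I q p'
     - \<eta> * (\<Sum>i\<in>I. (g' i - g i) * (p' i - q i)) - \<eta> * (\<Sum>i\<in>I. (g i - h i) * (p' i - ps i))
     = (\<Sum>i\<in>I. (c1 - \<eta> * c) * (p' i - ps i) + (c2 - c1) * (p' i - q i))"
    unfolding KL_def sum_distrib_left sum.distrib[symmetric] sum_subtractf[symmetric]
    by (rule sum.cong[OF refl *])
  also have "\<dots> = 0"
    unfolding sum.distrib sum_distrib_left[symmetric] sum_subtractf sums by simp
  finally show ?thesis by simp
qed

section \<open>Entropy bounds and the spread of log-probabilities\<close>

lemma KL_uniform:
  assumes "finite I" "p \<in> simplex_on I" "\<And>i. i \<in> I \<Longrightarrow> q i = 1 / real (card I)"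
  shows "KL I p q = ln (real (card I)) + (\<Sum>i\<in>I. p i * ln (p i))"
proof -
  have "KL I p q = (\<Sum>i\<in>I. p i * ln (real (card I)) + p i * ln (p i))"
    unfolding KL_def using assms(3) by (intro sum.cong) (auto simp: ln_div algebra_simps)
  then show ?thesis using assms(2) by (simp add: sum.distrib simplex_on_def flip: sum_distrib_right)
qed

lemma neg_entropy_nonpos:
  assumes "finite I" "p \<in> simplex_on I"
  shows "(\<Sum>i\<in>I. p i * ln (p i)) \<le> 0"
proof (rule sum_nonpos)
  fix i assume i: "i \<in> I"
  then have "0 \<le> p i" "p i \<le> 1"
    using assms member_le_sum[of i I p] by (auto simp: simplex_on_def)
  then show "p i * ln (p i) \<le> 0"
    by (cases "p i = 0") (auto simp: mult_nonneg_nonpos)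
qed

lemma neg_entropy_ge:
  assumes "finite I" "I \<noteq> {}" "p \<in> simplex_on I"
  shows "- ln (real (card I)) \<le> (\<Sum>i\<in>I. p i * ln (p i))"
proof -
  define u :: "'a \<Rightarrow> real" where "u = (\<lambda>_. 1 / real (card I))"
  have "u \<in> pos_simplex I" using assms by (auto simp: u_def pos_simplex_def card_gt_0_iff)
  then have "0 \<le> KL I p u" using KL_nonneg assms by blast
  then show ?thesis using KL_uniform[OF assms(1,3), of u] by (simp add: u_def)
qed

text \<open>Some coordinate is at most the average 1 / card I, so a spread of at most
  \<open>s\<close> bounds every ln (p i) by s - ln (card I), and averaging under \<open>p\<close>
  preserves this bound.\<close>

lemma neg_entropy_le_spread:
  assumes "finite I" "p \<in> pos_simplex I" "\<And>i j. i \<in> I \<Longrightarrow> j \<in> I \<Longrightarrow> ln (p i) - ln (p j) \<le> s"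
  shows "(\<Sum>i\<in>I. p i * ln (p i)) \<le> s - ln (real (card I))"
proof -
  have p: "\<And>i. i \<in> I \<Longrightarrow> 0 < p i" "sum p I = 1" using assms(2) by (auto simp: pos_simplex_def)
  then have ne: "I \<noteq> {}" by auto
  then have c: "0 < real (card I)" using assms(1) by (simp add: card_gt_0_iff)
  have "\<exists>j\<in>I. p j \<le> 1 / real (card I)"
  proof (rule ccontr)
    assume "\<not> ?thesis"
    then have "(\<Sum>i\<in>I. 1 / real (card I)) < sum p I"
      using assms(1) ne by (intro sum_strict_mono) (auto simp: not_le)
    then show False using c p(2) by simp
  qed
  then obtain j where j: "j \<in> I" "p j \<le> 1 / real (card I)" by blast
  have "ln (p j) \<le> ln (1 / real (card I))" using j p(1) c by (simp add: ln_le_cancel_iff)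
  also have "\<dots> = - ln (real (card I))" using c by (simp add: ln_div)
  finally have lj: "ln (p j) \<le> - ln (real (card I))" .
  have "(\<Sum>i\<in>I. p i * ln (p i)) \<le> (\<Sum>i\<in>I. p i * (s - ln (real (card I))))"
  proof (rule sum_mono)
    fix i assume i: "i \<in> I"
    have "ln (p i) \<le> s - ln (real (card I))" using assms(3)[OF i j(1)] lj by linarith
    then show "p i * ln (p i) \<le> p i * (s - ln (real (card I)))"
      using p(1)[OF i] by (intro mult_left_mono) auto
  qed
  also have "\<dots> = s - ln (real (card I))" using p(2) by (simp flip: sum_distrib_right)
  finally show ?thesis .
qed

text \<open>2 * K / \<tau> is the fixed point of the recursion s = (1 - \<eta> * \<tau>) * s + 2 *
  \<eta> * K for the largest log-ratio, hence an invariant of every update with payoffs bounded by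
  \<open>K\<close>.\<close>

lemma mw_step_spread:
  assumes "mw_step I \<eta> \<tau> p g q" "0 \<le> \<eta>" "\<eta> * \<tau> \<le> 1" "0 < \<tau>"
    and "\<And>i j. i \<in> I \<Longrightarrow> j \<in> I \<Longrightarrow> ln (p i) - ln (p j) \<le> 2 * K / \<tau>"
    and "\<And>i. i \<in> I \<Longrightarrow> \<bar>g i\<bar> \<le> K" and "i \<in> I" "j \<in> I"
  shows "ln (q i) - ln (q j) \<le> 2 * K / \<tau>"
proof -
  obtain c where c: "\<And>i. i \<in> I \<Longrightarrow> ln (q i) = (1 - \<eta> * \<tau>) * ln (p i) + \<eta> * g i + c"
    using assms(1) unfolding mw_step_def by blast
  have "ln (q i) - ln (q j) = (1 - \<eta> * \<tau>) * (ln (p i) - ln (p j)) + \<eta> * (g i - g j)"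
    unfolding c[OF assms(7)] c[OF assms(8)] by (simp add: algebra_simps)
  also have "\<dots> \<le> (1 - \<eta> * \<tau>) * (2 * K / \<tau>) + \<eta> * (2 * K)"
    using assms(2,3) assms(5)[OF assms(7,8)] assms(6)[OF assms(7)] assms(6)[OF assms(8)]
    by (intro add_mono mult_left_mono) auto
  also have "\<dots> = 2 * K / \<tau>" using assms(4) by (simp add: field_simps)
  finally show ?thesis .
qed

subsection \<open>Equilibria of the regularized game\<close>

locale matrix_game =
  fixes I :: "'a set" and J :: "'b set" and M :: "'a \<Rightarrow> 'b \<Rightarrow> real" and K \<tau> :: real
  assumes finite_I: "finite I" and I_ne: "I \<noteq> {}" and finite_J: "finite J" and J_ne: "J \<noteq> {}"
    and M_le: "\<And>i j. i \<in> I \<Longrightarrow> j \<in> J \<Longrightarrow> \<bar>M i j\<bar> \<le> K" and tau_pos: "0 < \<tau>"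
begin

definition gain :: "('b \<Rightarrow> real) \<Rightarrow> 'a \<Rightarrow> real" where
  "gain y i = (\<Sum>j\<in>J. M i j * y j)"

text \<open>The sign makes the minimising player perform the same \<open>mw_step\<close> as the
  maximising one.\<close>

definition cost :: "('a \<Rightarrow> real) \<Rightarrow> 'b \<Rightarrow> real" where
  "cost x j = - (\<Sum>i\<in>I. M i j * x i)"

definition bil :: "('a \<Rightarrow> real) \<Rightarrow> ('b \<Rightarrow> real) \<Rightarrow> real" where
  "bil x y = (\<Sum>i\<in>I. \<Sum>j\<in>J. x i * M i j * y j)"

text \<open>The first-order conditions of the entropy-regularized saddle point: each policy is the
  softmax of its payoffs divided by \<tau>, a logit or quantal response equilibrium. The constants
  \<open>c\<close> are Lagrange multipliers for total mass 1.\<close>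

definition equilibrium :: "('a \<Rightarrow> real) \<Rightarrow> ('b \<Rightarrow> real) \<Rightarrow> bool" where
  "equilibrium x y \<longleftrightarrow> x \<in> pos_simplex I \<and> y \<in> pos_simplex J \<and>
     (\<exists>c. \<forall>i\<in>I. \<tau> * ln (x i) = gain y i + c) \<and> (\<exists>c. \<forall>j\<in>J. \<tau> * ln (y j) = cost x j + c)"

lemma K_nonneg: "0 \<le> K"
  using I_ne J_ne M_le abs_ge_zero by (meson all_not_in_conv order_trans)

lemma sum_gain: "(\<Sum>i\<in>I. x i * gain y i) = bil x y"
  by (simp add: gain_def bil_def sum_distrib_left mult.assoc)

lemma sum_cost: "(\<Sum>j\<in>J. y j * cost x j) = - bil x y"
  unfolding cost_def bil_def
  by (subst sum.swap) (simp add: sum_distrib_left sum_negf mult_ac)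

lemma bil_diff_left: "bil (\<lambda>i. x i - x' i) y = bil x y - bil x' y"
  by (simp add: bil_def sum_subtractf algebra_simps)

lemma bil_diff_right: "bil x (\<lambda>j. y j - y' j) = bil x y - bil x y'"
  by (simp add: bil_def sum_subtractf algebra_simps)

lemma bil_lincomb_right: "bil x (\<lambda>j. c * y j + d * z j) = c * bil x y + d * bil x z"
  unfolding bil_def sum_distrib_left sum.distrib[symmetric]
  by (intro sum.cong refl) (simp add: algebra_simps)

lemma sum_gain_diff: "(\<Sum>i\<in>I. (gain y i - gain y' i) * (x i - x' i)) = bil (\<lambda>i. x i - x' i) (\<lambda>j. y j - y' j)"
proof -
  have "(\<Sum>i\<in>I. (gain y i - gain y' i) * (x i - x' i))
    = (\<Sum>i\<in>I. x i * gain y i) - (\<Sum>i\<in>I. x' i * gain y i) - ((\<Sum>i\<in>I. x i * gain y' i) - (\<Sum>i\<in>I. x' i * gain y' i))"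
    by (simp add: algebra_simps flip: sum_subtractf sum.distrib)
  then show ?thesis by (simp add: sum_gain bil_diff_left bil_diff_right)
qed

lemma sum_cost_diff: "(\<Sum>j\<in>J. (cost x j - cost x' j) * (y j - y' j)) = - bil (\<lambda>i. x i - x' i) (\<lambda>j. y j - y' j)"
proof -
  have "(\<Sum>j\<in>J. (cost x j - cost x' j) * (y j - y' j))
    = (\<Sum>j\<in>J. y j * cost x j) - (\<Sum>j\<in>J. y' j * cost x j) - ((\<Sum>j\<in>J. y j * cost x' j) - (\<Sum>j\<in>J. y' j * cost x' j))"
    by (simp add: algebra_simps flip: sum_subtractf sum.distrib)
  then show ?thesis by (simp add: sum_cost bil_diff_left bil_diff_right)
qed

lemma abs_bil_le: "\<bar>bil x y\<bar> \<le> K * (l1 I x * l1 J y)"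
proof -
  have "\<bar>bil x y\<bar> \<le> (\<Sum>i\<in>I. \<bar>\<Sum>j\<in>J. x i * M i j * y j\<bar>)"
    unfolding bil_def by (rule sum_abs)
  also have "\<dots> \<le> (\<Sum>i\<in>I. \<Sum>j\<in>J. \<bar>x i * M i j * y j\<bar>)"
    by (intro sum_mono sum_abs)
  also have "\<dots> \<le> (\<Sum>i\<in>I. \<Sum>j\<in>J. K * (\<bar>x i\<bar> * \<bar>y j\<bar>))"
  proof (intro sum_mono)
    fix i j assume "i \<in> I" "j \<in> J"
    then have "\<bar>M i j\<bar> * (\<bar>x i\<bar> * \<bar>y j\<bar>) \<le> K * (\<bar>x i\<bar> * \<bar>y j\<bar>)"
      by (intro mult_right_mono M_le) auto
    then show "\<bar>x i * M i j * y j\<bar> \<le> K * (\<bar>x i\<bar> * \<bar>y j\<bar>)"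
      by (simp add: abs_mult mult_ac)
  qed
  also have "\<dots> = K * (l1 I x * l1 J y)"
    by (simp only: l1_def sum_product) (simp only: sum_distrib_left)
  finally show ?thesis .
qed

lemma abs_bil_le_squares: "\<bar>bil x y\<bar> \<le> K * ((l1 I x)^2 / 2 + (l1 J y)^2 / 2)"
proof -
  have "l1 I x * l1 J y \<le> (l1 I x)^2 / 2 + (l1 J y)^2 / 2"
    using zero_le_power2[of "l1 I x - l1 J y"] by (simp add: power2_diff)
  then have "K * (l1 I x * l1 J y) \<le> K * ((l1 I x)^2 / 2 + (l1 J y)^2 / 2)"
    using K_nonneg by (rule mult_left_mono)
  then show ?thesis using abs_bil_le[of x y] by linarith
qed

lemma abs_gain_le: "y \<in> simplex_on J \<Longrightarrow> i \<in> I \<Longrightarrow> \<bar>gain y i\<bar> \<le> K"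
proof -
  assume y: "y \<in> simplex_on J" and i: "i \<in> I"
  have "\<bar>gain y i\<bar> \<le> (\<Sum>j\<in>J. K * y j)" unfolding gain_def
  proof (rule order_trans[OF sum_abs sum_mono])
    fix j assume "j \<in> J"
    then show "\<bar>M i j * y j\<bar> \<le> K * y j"
      using M_le[OF i] y by (auto simp: abs_mult simplex_on_def intro: mult_right_mono)
  qed
  then show ?thesis using y by (simp add: simplex_on_def flip: sum_distrib_left)
qed

lemma abs_cost_le: "x \<in> simplex_on I \<Longrightarrow> j \<in> J \<Longrightarrow> \<bar>cost x j\<bar> \<le> K"
proof -
  assume x: "x \<in> simplex_on I" and j: "j \<in> J"
  have "\<bar>cost x j\<bar> \<le> (\<Sum>i\<in>I. K * x i)" unfolding cost_def abs_minus_cancel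
  proof (rule order_trans[OF sum_abs sum_mono])
    fix i assume "i \<in> I"
    then show "\<bar>M i j * x i\<bar> \<le> K * x i"
      using M_le[OF _ j] x by (auto simp: abs_mult simplex_on_def intro: mult_right_mono)
  qed
  then show ?thesis using x by (simp add: simplex_on_def flip: sum_distrib_left)
qed

lemma abs_bil_simplex_le: "x \<in> simplex_on I \<Longrightarrow> y \<in> simplex_on J \<Longrightarrow> \<bar>bil x y\<bar> \<le> K"
  using abs_bil_le[of x y] by (simp add: l1_simplex)

text \<open>The column policy \<open>ys\<close> minimises \<open>L\<close> + \<open>N\<close>, where
  \<tau> * L y is the maximum over p of bil p y plus \<tau> times the entropy of p. With
  \<open>xs\<close> the row response to \<open>ys\<close>, first-order optimality says that
  \<open>ys\<close> does at least as well against the fixed \<open>xs\<close> as the softmax reply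
  \<open>yh\<close>. That reply is the unique optimum, so both coincide on \<open>J\<close>.\<close>

theorem equilibrium_exists: "\<exists>x y. equilibrium x y"
proof -
  define S where "S = {p \<in> simplex_on J. \<forall>j. j \<notin> J \<longrightarrow> p j = 0}"
  define N where "N = (\<lambda>y :: 'b \<Rightarrow> real. \<Sum>j\<in>J. y j * ln (y j))"
  define L where "L = (\<lambda>y. log_sum_exp I (\<lambda>i. gain y i / \<tau>))"
  define br where "br = (\<lambda>y. softmax I (\<lambda>i. gain y i / \<tau>))"
  have br: "br y \<in> pos_simplex I" for y
    unfolding br_def by (rule softmax_pos_simplex[OF finite_I I_ne])
  have L_eq: "L y = bil p y / \<tau> - (\<Sum>i\<in>I. p i * ln (p i)) + KL I p (br y)" if "p \<in> simplex_on I" for p y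
    unfolding L_def br_def using gibbs_variational[OF finite_I I_ne that, of "\<lambda>i. gain y i / \<tau>"]
    by (simp add: sum_gain flip: sum_divide_distrib)
  have coord: "continuous_on S (\<lambda>y. y j)" for j
    by (rule continuous_on_subset[OF continuous_on_product_coordinates subset_UNIV])
  have cont_gain: "continuous_on S (\<lambda>y. gain y i / \<tau>)" for i
    unfolding gain_def using tau_pos
    by (intro continuous_on_divide continuous_on_sum continuous_on_mult continuous_on_const coord) auto
  have "continuous_on S L"
    unfolding L_def log_sum_exp_def using sum_exp_pos[OF finite_I I_ne]
    by (intro continuous_on_ln continuous_on_sum continuous_on_exp cont_gain) (metis less_irrefl)
  moreover have "continuous_on S (\<lambda>y. y j * ln (y j))" if "j \<in> J" for j
    by (rule continuous_on_compose2[OF continuous_on_mult_ln])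
      (use that coord[of j] in \<open>auto simp: S_def simplex_on_def\<close>)
  ultimately have cont: "continuous_on S (\<lambda>y. L y + N y)"
    unfolding N_def by (intro continuous_on_add continuous_on_sum) auto
  have "(\<lambda>j. if j \<in> J then 1 / real (card J) else 0) \<in> S"
    using finite_J J_ne by (auto simp: S_def simplex_on_def)
  then have "S \<noteq> {}" by blast
  with cont obtain ys where ys: "ys \<in> S" and min: "\<And>y. y \<in> S \<Longrightarrow> L ys + N ys \<le> L y + N y"
    using continuous_attains_inf[of S "\<lambda>y. L y + N y"] compact_supported_simplex[OF finite_J]
    unfolding S_def by blast
  define xs where "xs = br ys"
  \<comment> \<open>The softmax reply is set to 0 outside \<open>J\<close>, so that it belongs to
    the compact set \<open>S\<close> and the segment \<open>Y\<close> stays there.\<close>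
  define yh where "yh = (\<lambda>j. if j \<in> J then softmax J (\<lambda>j. cost xs j / \<tau>) j else 0)"
  have yh_pos: "yh \<in> pos_simplex J"
    using softmax_pos_simplex[OF finite_J J_ne, of "\<lambda>j. cost xs j / \<tau>"]
    by (simp add: yh_def pos_simplex_def)
  have yhS: "yh \<in> S" using pos_simplex_subset[OF yh_pos] by (simp add: S_def yh_def)
  define Y where "Y = (\<lambda>s j. (1 - s) * ys j + s * yh j)"
  have ys': "ys \<in> simplex_on J" and yh': "yh \<in> simplex_on J" using ys yhS by (auto simp: S_def)
  \<comment> \<open>Only the second argument of the saddle function is moved, so convexity in that argument
      gives a bound in which the response to the moved point still appears; letting the move
      shrink replaces it by the response to the minimiser.\<close>
  have key: "L ys + N ys \<le> L (Y s) + bil (br (Y s)) (\<lambda>j. (1 - s) * (yh j - ys j)) / \<tau> + N yh"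
    if s: "0 < s" "s < 1" for s
  proof -
    have YS: "Y s \<in> S"
      using ys yhS s by (auto simp: S_def Y_def simplex_on_def sum.distrib simp flip: sum_distrib_left)
    have brs: "br (Y s) \<in> simplex_on I" by (rule pos_simplex_subset[OF br])
    define H where "H = (\<Sum>i\<in>I. br (Y s) i * ln (br (Y s) i))"
    have LY: "L (Y s) = bil (br (Y s)) (Y s) / \<tau> - H"
      using L_eq[OF brs, of "Y s"] by (simp add: H_def KL_def)
    have Lys: "bil (br (Y s)) ys / \<tau> - H \<le> L ys"
      using L_eq[OF brs, of ys] KL_nonneg[OF finite_I brs br[of ys]] by (simp add: H_def)
    have bilY: "bil (br (Y s)) (Y s) = (1 - s) * bil (br (Y s)) ys + s * bil (br (Y s)) yh"
      unfolding Y_def by (rule bil_lincomb_right)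
    have "N (Y s) \<le> (\<Sum>j\<in>J. (1 - s) * (ys j * ln (ys j)) + s * (yh j * ln (yh j)))"
      unfolding N_def Y_def
      by (rule sum_mono, rule mult_ln_convex) (use ys' yh' s in \<open>auto simp: simplex_on_def\<close>)
    then have NY: "N (Y s) \<le> (1 - s) * N ys + s * N yh"
      by (simp add: N_def sum.distrib sum_distrib_left)
    have "L ys + N ys \<le> L (Y s) + N (Y s)" by (rule min[OF YS])
    also have "\<dots> \<le> (1 - s) * (bil (br (Y s)) ys / \<tau> - H + N ys) + s * (bil (br (Y s)) yh / \<tau> - H + N yh)"
      using NY unfolding LY bilY by (simp add: algebra_simps add_divide_distrib diff_divide_distrib)
    also have "\<dots> \<le> (1 - s) * (L ys + N ys) + s * (bil (br (Y s)) yh / \<tau> - H + N yh)"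
      using Lys s by (intro add_right_mono mult_left_mono) auto
    \<comment> \<open>The (1 - s) share of the minimum cancels, and the factor s left on both sides
      can be divided out.\<close>
    finally have "s * (L ys + N ys) \<le> s * (bil (br (Y s)) yh / \<tau> - H + N yh)"
      by (simp add: algebra_simps)
    then have "L ys + N ys \<le> bil (br (Y s)) yh / \<tau> - H + N yh" using s by simp
    also have "bil (br (Y s)) yh = bil (br (Y s)) (Y s) + bil (br (Y s)) (\<lambda>j. (1 - s) * (yh j - ys j))"
      unfolding bil_def sum.distrib[symmetric] by (intro sum.cong refl) (simp add: Y_def algebra_simps)
    finally show ?thesis using LY by (simp add: add_divide_distrib)
  qed
  have ne: "(\<Sum>k\<in>I. exp (g k)) \<noteq> (0::real)" for g
    using sum_exp_pos[OF finite_I I_ne, of g] by simp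
  have "Y 0 = ys" by (simp add: Y_def)
  have lim_gain: "((\<lambda>s. gain (Y s) i / \<tau>) \<longlongrightarrow> gain (Y 0) i / \<tau>) (at_right 0)" for i
    unfolding gain_def Y_def using tau_pos by (intro tendsto_intros) auto
  have lim_br: "((\<lambda>s. br (Y s) i) \<longlongrightarrow> br (Y 0) i) (at_right 0)" for i
    unfolding br_def softmax_def
    by (intro tendsto_divide tendsto_sum tendsto_exp lim_gain ne)
  have lim_L: "((\<lambda>s. L (Y s)) \<longlongrightarrow> L (Y 0)) (at_right 0)"
    unfolding L_def log_sum_exp_def
    by (intro tendsto_ln tendsto_sum tendsto_exp lim_gain ne)
  have lim_bil: "((\<lambda>s. bil (br (Y s)) (\<lambda>j. (1 - s) * (yh j - ys j))) \<longlongrightarrow> bil (br (Y 0)) (\<lambda>j. (1 - 0) * (yh j - ys j))) (at_right 0)"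
    unfolding bil_def by (intro tendsto_intros lim_br)
  have "L ys + N ys \<le> L (Y 0) + bil (br (Y 0)) (\<lambda>j. (1 - 0) * (yh j - ys j)) / \<tau> + N yh"
  proof (rule tendsto_lowerbound)
    show "((\<lambda>s. L (Y s) + bil (br (Y s)) (\<lambda>j. (1 - s) * (yh j - ys j)) / \<tau> + N yh)
      \<longlongrightarrow> L (Y 0) + bil (br (Y 0)) (\<lambda>j. (1 - 0) * (yh j - ys j)) / \<tau> + N yh) (at_right 0)"
      using tau_pos by (intro tendsto_add tendsto_divide lim_L lim_bil tendsto_const) auto
    show "\<forall>\<^sub>F s in at_right 0. L ys + N ys \<le> L (Y s) + bil (br (Y s)) (\<lambda>j. (1 - s) * (yh j - ys j)) / \<tau> + N yh"
      by (rule eventually_mono[OF eventually_at_right_real[of 0 1]]) (auto intro: key)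
  qed simp
  \<comment> \<open>At s = 0 the bilinear remainder is bil xs (yh - ys), which turns the limit into
    a comparison of \<open>ys\<close> and \<open>yh\<close> in the column player's problem against
    \<open>xs\<close>.\<close>
  then have le: "N ys + bil xs ys / \<tau> \<le> N yh + bil xs yh / \<tau>"
    by (simp add: \<open>Y 0 = ys\<close> bil_diff_right diff_divide_distrib xs_def)
  \<comment> \<open>Up to a constant, that column objective is the divergence from the softmax
    reply. The divergence is 0 at \<open>yh\<close>, hence at most 0 at \<open>ys\<close>.\<close>
  have KLeq: "KL J y (softmax J (\<lambda>j. cost xs j / \<tau>)) = log_sum_exp J (\<lambda>j. cost xs j / \<tau>) + bil xs y / \<tau> + N y"
    if "y \<in> simplex_on J" for y
    using gibbs_variational[OF finite_J J_ne that, of "\<lambda>j. cost xs j / \<tau>"]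
    by (simp add: N_def sum_cost flip: sum_divide_distrib)
  have "KL J yh (softmax J (\<lambda>j. cost xs j / \<tau>)) = 0"
    by (simp add: KL_def yh_def)
  then have "KL J ys (softmax J (\<lambda>j. cost xs j / \<tau>)) \<le> 0"
    using le KLeq[OF ys'] KLeq[OF yh'] by linarith
  then have eq: "ys j = softmax J (\<lambda>j. cost xs j / \<tau>) j" if "j \<in> J" for j
    using KL_nonpos_imp_eq[OF finite_J ys' softmax_pos_simplex[OF finite_J J_ne] _ that] by blast
  have "ys \<in> pos_simplex J"
    using softmax_pos_simplex[OF finite_J J_ne, of "\<lambda>j. cost xs j / \<tau>"] eq by (simp add: pos_simplex_def)
  moreover have "\<tau> * ln (xs i) = gain ys i + (- \<tau> * L ys)" for i
    using tau_pos by (simp add: xs_def br_def ln_softmax[OF finite_I I_ne] L_def algebra_simps)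
  moreover have "\<tau> * ln (ys j) = cost xs j + (- \<tau> * log_sum_exp J (\<lambda>j. cost xs j / \<tau>))" if "j \<in> J" for j
    using tau_pos by (simp add: eq[OF that] ln_softmax[OF finite_J J_ne] algebra_simps)
  ultimately have "equilibrium xs ys"
    unfolding equilibrium_def using br[of ys] by (auto simp: xs_def)
  then show ?thesis by blast
qed

subsection \<open>Contraction towards the equilibrium\<close>

definition KL_pair :: "('a \<Rightarrow> real) \<Rightarrow> ('b \<Rightarrow> real) \<Rightarrow> ('a \<Rightarrow> real) \<Rightarrow> ('b \<Rightarrow> real) \<Rightarrow> real" where
  "KL_pair x y x' y' = KL I x x' + KL J y y'"

lemma KL_pair_nonneg:
  assumes "x \<in> simplex_on I" "y \<in> simplex_on J" "x' \<in> pos_simplex I" "y' \<in> pos_simplex J"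
  shows "0 \<le> KL_pair x y x' y'"
  unfolding KL_pair_def using assms finite_I finite_J by (intro add_nonneg_nonneg KL_nonneg)

lemma bil_le_KL:
  assumes "(l1 I x)^2 \<le> 2 * a" "(l1 J y)^2 \<le> 2 * b"
  shows "\<bar>bil x y\<bar> \<le> K * (a + b)"
proof -
  have "K * ((l1 I x)^2 / 2 + (l1 J y)^2 / 2) \<le> K * (a + b)"
    using assms K_nonneg by (intro mult_left_mono) auto
  then show ?thesis using abs_bil_le_squares[of x y] by linarith
qed

text \<open>For interior policies both argument orders are available, so a squared distance can be
  charged to whichever divergence the identity below leaves with a negative sign.\<close>

lemma pinsker_pos:
  assumes "finite S" "p \<in> pos_simplex S" "q \<in> pos_simplex S"
  shows "(l1 S (\<lambda>i. p i - q i))^2 \<le> 2 * KL S p q" "(l1 S (\<lambda>i. p i - q i))^2 \<le> 2 * KL S q p"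
  using pinsker[OF assms(1) pos_simplex_subset[OF assms(2)] assms(3)]
    pinsker[OF assms(1) pos_simplex_subset[OF assms(3)] assms(2)]
  by (simp_all add: l1_minus_commute[of S q p])

text \<open>\<open>xo\<close>, \<open>yo\<close> is the pair whose payoffs drive the extrapolation:
  the current pair for PU, the previous extrapolated pair for OMWU. The two final bilinear terms are
  the price of stepping with payoffs other than those used to extrapolate.\<close>

lemma extragradient_identity:
  assumes eq: "equilibrium xs ys"
    and "mw_step I \<eta> \<tau> x (gain yo) xb" "mw_step J \<eta> \<tau> y (cost xo) yb"
    and "mw_step I \<eta> \<tau> x (gain yb) x'" "mw_step J \<eta> \<tau> y (cost xb) y'"
  shows "KL_pair xs ys x' y' = (1 - \<eta> * \<tau>) * (KL_pair xs ys x y - KL_pair xb yb x y)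
     - \<eta> * \<tau> * KL_pair xb yb xs ys - KL_pair x' y' xb yb
     + \<eta> * (bil (\<lambda>i. xb i - x' i) (\<lambda>j. yo j - yb j) - bil (\<lambda>i. xo i - xb i) (\<lambda>j. yb j - y' j))"
proof -
  obtain c d where c: "\<forall>i\<in>I. \<tau> * ln (xs i) = gain ys i + c" and d: "\<forall>j\<in>J. \<tau> * ln (ys j) = cost xs j + d"
    and pos: "xs \<in> pos_simplex I" "ys \<in> pos_simplex J"
    using eq unfolding equilibrium_def by blast
  show ?thesis
    unfolding KL_pair_def
      mw_step_three_point[OF assms(2) assms(4) pos(1) c] mw_step_three_point[OF assms(3) assms(5) pos(2) d]
      sum_gain_diff sum_cost_diff
    by (simp add: algebra_simps)
qed

text \<open>The mixed terms cost at most \<eta> * K times each of \<open>KL_pair x' y' xb yb\<close>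
  and \<open>KL_pair xb yb x y\<close>, for which the identity supplies the coefficients 1 and 1 -
  \<eta> * \<tau>. The rate condition makes both remainders nonnegative.\<close>

lemma pu_contraction:
  assumes eq: "equilibrium xs ys" and xy: "x \<in> pos_simplex I" "y \<in> pos_simplex J"
    and steps: "mw_step I \<eta> \<tau> x (gain y) xb" "mw_step J \<eta> \<tau> y (cost x) yb"
    "mw_step I \<eta> \<tau> x (gain yb) x'" "mw_step J \<eta> \<tau> y (cost xb) y'"
    and eta: "0 < \<eta>" "\<eta> * (\<tau> + 2 * K) \<le> 1"
  shows "KL_pair xs ys x' y' + \<eta> * \<tau> * KL_pair xb yb xs ys \<le> (1 - \<eta> * \<tau>) * KL_pair xs ys x y"
proof -
  have pos: "xb \<in> pos_simplex I" "yb \<in> pos_simplex J" "x' \<in> pos_simplex I" "y' \<in> pos_simplex J"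
    using steps by (auto simp: mw_step_def)
  have b1: "\<bar>bil (\<lambda>i. xb i - x' i) (\<lambda>j. y j - yb j)\<bar> \<le> K * (KL I x' xb + KL J yb y)"
    using pos xy by (intro bil_le_KL pinsker_pos finite_I finite_J)
  have b2: "\<bar>bil (\<lambda>i. x i - xb i) (\<lambda>j. yb j - y' j)\<bar> \<le> K * (KL I xb x + KL J y' yb)"
    using pos xy by (intro bil_le_KL pinsker_pos finite_I finite_J)
  have "bil (\<lambda>i. xb i - x' i) (\<lambda>j. y j - yb j) - bil (\<lambda>i. x i - xb i) (\<lambda>j. yb j - y' j)
    \<le> K * (KL_pair x' y' xb yb + KL_pair xb yb x y)"
    using b1 b2 by (simp add: KL_pair_def algebra_simps abs_le_iff)
  then have le: "\<eta> * (bil (\<lambda>i. xb i - x' i) (\<lambda>j. y j - yb j) - bil (\<lambda>i. x i - xb i) (\<lambda>j. yb j - y' j))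
    \<le> \<eta> * (K * (KL_pair x' y' xb yb + KL_pair xb yb x y))"
    using eta(1) by (intro mult_left_mono) auto
  have nn: "0 \<le> KL_pair x' y' xb yb" "0 \<le> KL_pair xb yb x y"
    using pos xy by (auto intro!: KL_pair_nonneg pos_simplex_subset)
  have "0 \<le> \<eta> * K" "0 \<le> \<eta> * \<tau>" using eta(1) K_nonneg tau_pos by auto
  moreover have "\<eta> * \<tau> + 2 * (\<eta> * K) \<le> 1" using eta(2) by (simp add: algebra_simps)
  ultimately have "0 \<le> 1 - \<eta> * K" "0 \<le> 1 - \<eta> * \<tau> - \<eta> * K" by linarith+
  then have "0 \<le> (1 - \<eta> * K) * KL_pair x' y' xb yb" "0 \<le> (1 - \<eta> * \<tau> - \<eta> * K) * KL_pair xb yb x y"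
    using nn by simp_all
  then show ?thesis
    using le unfolding extragradient_identity[OF eq steps] by (simp add: algebra_simps)
qed

text \<open>The extrapolation uses the stale pair \<open>xo\<close>, \<open>yo\<close>, so its error
  is split through the current pair. The stale part costs \<eta> * K times
  \<open>KL_pair x y xo yo\<close>, inherited from the previous step. The potential stores this
  divergence with weight 1 - 2 * \<eta> * K, exactly what the charge of 2 * \<eta> * K leaves of the
  new one.\<close>

lemma omwu_contraction:
  assumes eq: "equilibrium xs ys" and xy: "x \<in> pos_simplex I" "y \<in> pos_simplex J"
    and xyo: "xo \<in> pos_simplex I" "yo \<in> pos_simplex J"
    and steps: "mw_step I \<eta> \<tau> x (gain yo) xb" "mw_step J \<eta> \<tau> y (cost xo) yb"
    "mw_step I \<eta> \<tau> x (gain yb) x'" "mw_step J \<eta> \<tau> y (cost xb) y'"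
    and eta: "0 < \<eta>" "\<eta> * (2 * \<tau> + 2 * K) \<le> 1" "\<eta> * (4 * K) \<le> 1"
  shows "KL_pair xs ys x' y' + (1 - 2 * (\<eta> * K)) * KL_pair x' y' xb yb + \<eta> * \<tau> * KL_pair xb yb xs ys
    \<le> (1 - \<eta> * \<tau>) * (KL_pair xs ys x y + (1 - 2 * (\<eta> * K)) * KL_pair x y xo yo)"
proof -
  have pos: "xb \<in> pos_simplex I" "yb \<in> pos_simplex J" "x' \<in> pos_simplex I" "y' \<in> pos_simplex J"
    using steps by (auto simp: mw_step_def)
  have b1: "\<bar>bil (\<lambda>i. xb i - x' i) (\<lambda>j. y j - yb j)\<bar> \<le> K * (KL I x' xb + KL J yb y)"
    using pos xy by (intro bil_le_KL pinsker_pos finite_I finite_J)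
  have b1': "\<bar>bil (\<lambda>i. xb i - x' i) (\<lambda>j. yo j - y j)\<bar> \<le> K * (KL I x' xb + KL J y yo)"
    using pos xy xyo by (intro bil_le_KL pinsker_pos finite_I finite_J)
  have b2: "\<bar>bil (\<lambda>i. x i - xb i) (\<lambda>j. yb j - y' j)\<bar> \<le> K * (KL I xb x + KL J y' yb)"
    using pos xy by (intro bil_le_KL pinsker_pos finite_I finite_J)
  have b2': "\<bar>bil (\<lambda>i. xo i - x i) (\<lambda>j. yb j - y' j)\<bar> \<le> K * (KL I x xo + KL J y' yb)"
    using pos xy xyo by (intro bil_le_KL pinsker_pos finite_I finite_J)
  have "bil (\<lambda>i. xb i - x' i) (\<lambda>j. yo j - yb j) - bil (\<lambda>i. xo i - xb i) (\<lambda>j. yb j - y' j)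
    = bil (\<lambda>i. xb i - x' i) (\<lambda>j. y j - yb j) + bil (\<lambda>i. xb i - x' i) (\<lambda>j. yo j - y j)
     - bil (\<lambda>i. x i - xb i) (\<lambda>j. yb j - y' j) - bil (\<lambda>i. xo i - x i) (\<lambda>j. yb j - y' j)"
    by (simp add: bil_diff_left bil_diff_right)
  also have "\<dots> \<le> K * (2 * KL_pair x' y' xb yb + KL_pair x y xo yo + KL_pair xb yb x y)"
    using b1 b2 b1' b2' by (simp add: KL_pair_def algebra_simps abs_le_iff)
  finally have le: "\<eta> * (bil (\<lambda>i. xb i - x' i) (\<lambda>j. yo j - yb j) - bil (\<lambda>i. xo i - xb i) (\<lambda>j. yb j - y' j))
    \<le> \<eta> * (K * (2 * KL_pair x' y' xb yb + KL_pair x y xo yo + KL_pair xb yb x y))"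
    using eta(1) by (intro mult_left_mono) auto
  have nn: "0 \<le> KL_pair x y xo yo" "0 \<le> KL_pair xb yb x y"
    using pos xy xyo by (auto intro!: KL_pair_nonneg pos_simplex_subset)
  define k t where "k = \<eta> * K" and "t = \<eta> * \<tau>"
  have k: "0 \<le> k" "4 * k \<le> 1" and t: "0 \<le> t" "2 * t + 2 * k \<le> 1"
    using eta K_nonneg tau_pos by (auto simp: k_def t_def algebra_simps)
  \<comment> \<open>k \<le> 1/4 and 1 - t \<ge> 1/2 + k give (1 - t) * (1 - 2 * k) \<ge> 1/2 - 2 *
    k^2 \<ge> 3/8, so the stored weight covers the inherited cost k.\<close>
  have "k * k \<le> 1/4 * (1/4)" using k by (intro mult_mono) auto
  moreover have "(1/2 + k) * (1 - 2 * k) \<le> (1 - t) * (1 - 2 * k)"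
    using k t by (intro mult_right_mono) auto
  ultimately have "k \<le> (1 - t) * (1 - 2 * k)" using k by (simp add: algebra_simps)
  then have "k * KL_pair x y xo yo \<le> (1 - t) * (1 - 2 * k) * KL_pair x y xo yo"
    using nn by (intro mult_right_mono)
  moreover have "0 \<le> (1 - t - k) * KL_pair xb yb x y"
    using nn k t by (intro mult_nonneg_nonneg) auto
  ultimately show ?thesis
    using le unfolding extragradient_identity[OF eq steps] k_def t_def by (simp add: algebra_simps)
qed

section \<open>Duality gaps bounded by divergences and by log-ratios\<close>

lemma KL_pair_uniform:
  assumes "x \<in> simplex_on I" "y \<in> simplex_on J"
    and "\<And>i. i \<in> I \<Longrightarrow> u i = 1 / real (card I)" "\<And>j. j \<in> J \<Longrightarrow> v j = 1 / real (card J)"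
  shows "KL_pair x y u v \<le> ln (real (card I)) + ln (real (card J))"
  using KL_uniform[of I x u] KL_uniform[of J y v] neg_entropy_nonpos[of I x] neg_entropy_nonpos[of J y]
    assms finite_I finite_J by (simp add: KL_pair_def)

definition reg_game :: "('a \<Rightarrow> real) \<Rightarrow> ('b \<Rightarrow> real) \<Rightarrow> real" where
  "reg_game x y = bil x y - \<tau> * (\<Sum>i\<in>I. x i * ln (x i)) + \<tau> * (\<Sum>j\<in>J. y j * ln (y j))"

text \<open>Around the equilibrium the gap expands exactly into divergences and two bilinear terms.
  The comparison policies \<open>p\<close> and \<open>q\<close> may be far away, but strong
  concavity gives them divergences with coefficient - \<tau>; these absorb one part of Young's
  inequality and leave K^2 / \<tau> on the divergence of \<open>x\<close> and
  \<open>y\<close>.\<close>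

lemma reg_gap_le_KL_pair:
  assumes eq: "equilibrium xs ys" and xy: "x \<in> pos_simplex I" "y \<in> pos_simplex J"
    and pq: "p \<in> simplex_on I" "q \<in> simplex_on J"
  shows "reg_game p y - reg_game x q \<le> (\<tau> + K^2 / \<tau>) * KL_pair x y xs ys"
proof -
  obtain c d where c: "\<And>i. i \<in> I \<Longrightarrow> \<tau> * ln (xs i) = gain ys i + c"
    and d: "\<And>j. j \<in> J \<Longrightarrow> \<tau> * ln (ys j) = cost xs j + d"
    and pos: "xs \<in> pos_simplex I" "ys \<in> pos_simplex J"
    using eq unfolding equilibrium_def by blast
  have KI: "\<tau> * KL I p xs = \<tau> * (\<Sum>i\<in>I. p i * ln (p i)) - bil p ys - c" if "p \<in> simplex_on I" for p
  proof -
    have "\<tau> * KL I p xs = (\<Sum>i\<in>I. \<tau> * (p i * ln (p i)) - p i * gain ys i - p i * c)"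
      unfolding KL_def sum_distrib_left
    proof (rule sum.cong[OF refl])
      fix i assume "i \<in> I"
      have "\<tau> * (p i * (ln (p i) - ln (xs i))) = \<tau> * (p i * ln (p i)) - p i * (\<tau> * ln (xs i))"
        by (simp add: algebra_simps)
      then show "\<tau> * (p i * (ln (p i) - ln (xs i))) = \<tau> * (p i * ln (p i)) - p i * gain ys i - p i * c"
        unfolding c[OF \<open>i \<in> I\<close>] by (simp add: algebra_simps)
    qed
    then show ?thesis using that
      by (simp add: sum_subtractf sum_gain simplex_on_def flip: sum_distrib_left sum_distrib_right)
  qed
  have KJ: "\<tau> * KL J q ys = \<tau> * (\<Sum>j\<in>J. q j * ln (q j)) + bil xs q - d" if "q \<in> simplex_on J" for q
  proof -
    have "\<tau> * KL J q ys = (\<Sum>j\<in>J. \<tau> * (q j * ln (q j)) - q j * cost xs j - q j * d)"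
      unfolding KL_def sum_distrib_left
    proof (rule sum.cong[OF refl])
      fix j assume "j \<in> J"
      have "\<tau> * (q j * (ln (q j) - ln (ys j))) = \<tau> * (q j * ln (q j)) - q j * (\<tau> * ln (ys j))"
        by (simp add: algebra_simps)
      then show "\<tau> * (q j * (ln (q j) - ln (ys j))) = \<tau> * (q j * ln (q j)) - q j * cost xs j - q j * d"
        unfolding d[OF \<open>j \<in> J\<close>] by (simp add: algebra_simps)
    qed
    then show ?thesis using that
      by (simp add: sum_subtractf sum_cost simplex_on_def flip: sum_distrib_left sum_distrib_right)
  qed
  \<comment> \<open>The disjunction lets either factor receive the weight \<tau>, so that this part
    always falls on the comparison policy.\<close>
  have young: "\<bar>bil u v\<bar> \<le> \<tau> * (s / 2) + K^2 / \<tau> * (r / 2)"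
    if "(l1 I u)^2 \<le> s \<and> (l1 J v)^2 \<le> r \<or> (l1 J v)^2 \<le> s \<and> (l1 I u)^2 \<le> r" for u v s r
  proof -
    have y: "K * (a * b) \<le> \<tau> * (s / 2) + K^2 / \<tau> * (r / 2)" if "a^2 \<le> s" "b^2 \<le> r" for a b :: real
    proof -
      have "0 \<le> (\<tau> * a - K * b)^2 / (2 * \<tau>)" using tau_pos by simp
      also have "\<dots> = \<tau> * (a^2 / 2) + K^2 / \<tau> * (b^2 / 2) - K * (a * b)"
        using tau_pos by (simp add: field_simps power2_eq_square)
      finally have "K * (a * b) \<le> \<tau> * (a^2 / 2) + K^2 / \<tau> * (b^2 / 2)" by simp
      also have "\<dots> \<le> \<tau> * (s / 2) + K^2 / \<tau> * (r / 2)"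
        using that tau_pos by (intro add_mono mult_left_mono) auto
      finally show ?thesis .
    qed
    have "K * (l1 I u * l1 J v) \<le> \<tau> * (s / 2) + K^2 / \<tau> * (r / 2)"
      using that y[of "l1 I u" "l1 J v"] y[of "l1 J v" "l1 I u"] by (auto simp: mult.commute)
    then show ?thesis using abs_bil_le[of u v] by linarith
  qed
  note sx = pos_simplex_subset[OF xy(1)] and sy = pos_simplex_subset[OF xy(2)]
  have b1: "\<bar>bil (\<lambda>i. p i - xs i) (\<lambda>j. y j - ys j)\<bar> \<le> \<tau> * (2 * KL I p xs / 2) + K^2 / \<tau> * (2 * KL J y ys / 2)"
    using pinsker[OF finite_I pq(1) pos(1)] pinsker[OF finite_J sy pos(2)] by (intro young) auto
  have b2: "\<bar>bil (\<lambda>i. x i - xs i) (\<lambda>j. q j - ys j)\<bar> \<le> \<tau> * (2 * KL J q ys / 2) + K^2 / \<tau> * (2 * KL I x xs / 2)"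
    using pinsker[OF finite_J pq(2) pos(2)] pinsker[OF finite_I sx pos(1)] by (intro young) auto
  have "reg_game p y - reg_game x q = \<tau> * KL I x xs + \<tau> * KL J y ys - \<tau> * KL I p xs - \<tau> * KL J q ys
     + bil (\<lambda>i. p i - xs i) (\<lambda>j. y j - ys j) - bil (\<lambda>i. x i - xs i) (\<lambda>j. q j - ys j)"
    unfolding KI[OF sx] KJ[OF sy] KI[OF pq(1)] KJ[OF pq(2)] reg_game_def bil_diff_left bil_diff_right
    by simp
  then show ?thesis using b1 b2 by (simp add: KL_pair_def algebra_simps abs_le_iff)
qed

text \<open>Each entropy is within 2 * K / \<tau> of its maximum, so the entropy terms can improve
  by at most 4 * K in total; the two bilinear values, of size at most \<open>K\<close> each,
  contribute the other 2 * K.\<close>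

lemma reg_gap_le_spread:
  assumes xy: "x \<in> pos_simplex I" "y \<in> pos_simplex J"
    and sp: "\<And>i j. i \<in> I \<Longrightarrow> j \<in> I \<Longrightarrow> ln (x i) - ln (x j) \<le> 2 * K / \<tau>"
      "\<And>i j. i \<in> J \<Longrightarrow> j \<in> J \<Longrightarrow> ln (y i) - ln (y j) \<le> 2 * K / \<tau>"
    and pq: "p \<in> simplex_on I" "q \<in> simplex_on J"
  shows "reg_game p y - reg_game x q \<le> 6 * K"
proof -
  note sx = pos_simplex_subset[OF xy(1)] and sy = pos_simplex_subset[OF xy(2)]
  have "(\<Sum>i\<in>I. x i * ln (x i)) + (\<Sum>j\<in>J. y j * ln (y j)) - (\<Sum>i\<in>I. p i * ln (p i)) - (\<Sum>j\<in>J. q j * ln (q j))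
    \<le> 4 * K / \<tau>"
    using neg_entropy_le_spread[OF finite_I xy(1) sp(1)] neg_entropy_le_spread[OF finite_J xy(2) sp(2)]
      neg_entropy_ge[OF finite_I I_ne pq(1)] neg_entropy_ge[OF finite_J J_ne pq(2)] by simp
  then have "\<tau> * ((\<Sum>i\<in>I. x i * ln (x i)) + (\<Sum>j\<in>J. y j * ln (y j)) - (\<Sum>i\<in>I. p i * ln (p i)) - (\<Sum>j\<in>J. q j * ln (q j)))
    \<le> 4 * K"
    using tau_pos by (simp add: pos_le_divide_eq mult.commute)
  then show ?thesis
    using abs_bil_simplex_le[OF pq(1) sy] abs_bil_simplex_le[OF sx pq(2)]
    by (simp add: reg_game_def algebra_simps abs_le_iff)
qed

lemma bil_gap_le_reg_gap:
  assumes "x \<in> simplex_on I" "y \<in> simplex_on J" "p \<in> simplex_on I" "q \<in> simplex_on J"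
  shows "bil p y - bil x q \<le> reg_game p y - reg_game x q + \<tau> * (ln (real (card I)) + ln (real (card J)))"
proof -
  have "0 \<le> \<tau> * (ln (real (card I)) + ln (real (card J)) + (\<Sum>i\<in>I. x i * ln (x i)) + (\<Sum>j\<in>J. y j * ln (y j))
      - (\<Sum>i\<in>I. p i * ln (p i)) - (\<Sum>j\<in>J. q j * ln (q j)))"
    using neg_entropy_ge[OF finite_I I_ne assms(1)] neg_entropy_ge[OF finite_J J_ne assms(2)]
      neg_entropy_nonpos[OF finite_I assms(3)] neg_entropy_nonpos[OF finite_J assms(4)] tau_pos
    by (intro mult_nonneg_nonneg) auto
  then show ?thesis by (simp add: reg_game_def algebra_simps)
qed

end

text \<open>\<open>V\<close> is the potential and \<open>D\<close> the divergence to be controlled.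
  The bound starts at \<open>Suc t\<close> because the recursion mentions \<open>D\<close> only
  after a step.\<close>

lemma lyapunov_decay:
  fixes V D :: "nat \<Rightarrow> real"
  assumes "\<And>t. V (Suc t) + a * D (Suc t) \<le> (1 - a) * V t" "\<And>t. 0 \<le> V t" "\<And>t. 0 \<le> D t"
    "0 \<le> a" "a \<le> 1" "V 0 \<le> L"
  shows "a * D (Suc t) \<le> (1 - a) ^ Suc t * L"
proof -
  have V: "V t \<le> (1 - a) ^ t * L" for t
  proof (induction t)
    case 0
    then show ?case using assms by simp
  next
    case (Suc t)
    have "V (Suc t) \<le> (1 - a) * V t"
      using assms(1)[of t] assms(3)[of "Suc t"] assms(4) by (smt (verit) mult_nonneg_nonneg)
    also have "\<dots> \<le> (1 - a) * ((1 - a) ^ t * L)" using Suc assms(5) by (intro mult_left_mono) auto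
    finally show ?case by simp
  qed
  have "a * D (Suc t) \<le> (1 - a) * V t" using assms(1)[of t] assms(2)[of "Suc t"] by linarith
  also have "\<dots> \<le> (1 - a) * ((1 - a) ^ t * L)" using V[of t] assms(5) by (intro mult_left_mono) auto
  finally show ?thesis by simp
qed

subsection \<open>Number of iterations\<close>

lemma soft_O_bound_nonneg: "0 \<le> C \<Longrightarrow> 0 \<le> x \<Longrightarrow> 0 \<le> soft_O_bound C k m n x"
  by (simp add: soft_O_bound_def)

text \<open>The condition 1 / \<eta> \<le> 2 * \<tau> + 4 * K covers the largest rates of both
  methods, where 1 / \<eta> is \<tau> + 2 * K or the maximum of 2 * \<tau> + 2 * K and 4 * K. If 12
  * K \<le> \<epsilon>, the uniform bound settles the claim at time 0; otherwise K / \<epsilon>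
  exceeds 1 / 12, and additive constants can be charged to it.\<close>

lemma iteration_count:
  fixes m n :: nat and \<epsilon> \<tau> \<eta> K :: real and gap :: "nat \<Rightarrow> real"
  defines "L \<equiv> ln (real m) + ln (real n)"
  assumes mn: "1 \<le> m" "1 \<le> n" and L: "0 < L" and eps: "0 < \<epsilon>" and tau: "\<tau> = \<epsilon> / 4 / L"
    and K: "0 \<le> K" and eta: "0 < \<eta>" "\<eta> * (\<tau> + 2 * K) \<le> 1"
    and gap_0: "\<And>t. gap t \<le> 6 * K"
    and gap_decay: "\<And>t. gap (Suc t) \<le> (\<tau> + K^2 / \<tau>) * ((1 - \<eta> * \<tau>) ^ Suc t * L / (\<eta> * \<tau>))"
  shows "\<exists>T. real T \<le> soft_O_bound 16128 2 m n (1 / (\<eta> * \<epsilon>)) \<and>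
     (1 / \<eta> \<le> 2 * \<tau> + 4 * K \<longrightarrow> real T \<le> soft_O_bound 16128 2 m n (K / \<epsilon>)) \<and>
     (\<forall>t\<ge>T. gap t \<le> \<epsilon> / 2)"
proof (cases "12 * K \<le> \<epsilon>")
  case True
  have "gap t \<le> \<epsilon> / 2" for t using gap_0[of t] True by simp
  then show ?thesis using eps eta K by (intro exI[of _ 0]) (simp add: soft_O_bound_nonneg)
next
  case False
  define y where "y = 1 / (\<eta> * \<epsilon>)"
  define z where "z = 1 / (\<eta> * \<tau>)"
  define W where "W = ln (2 + real m + real n + y)"
  have tau_pos: "0 < \<tau>" using tau eps L by simp
  have et: "0 < \<eta> * \<tau>" using eta(1) tau_pos by simp
  have etK: "\<eta> * \<tau> + 2 * (\<eta> * K) \<le> 1" using eta(2) by (simp add: algebra_simps)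
  have eK: "0 \<le> \<eta> * K" using eta(1) K by simp
  have et1: "\<eta> * \<tau> \<le> 1" using etK eK by linarith
  have z1: "1 \<le> z" using et et1 by (simp add: z_def)
  have y_pos: "0 < y" using eta eps by (simp add: y_def)
  have zy: "z = 4 * L * y" using tau eps L by (simp add: z_def y_def)
  have Ktau: "K / \<tau> \<le> z / 2"
  proof -
    have "2 * (\<eta> * K) \<le> 1" using etK et by linarith
    then show ?thesis using et tau_pos eta(1) by (simp add: z_def field_simps)
  qed
  \<comment> \<open>The decay must beat the prefactor (1 + (z / 2)^2) * z of order z^3, hence the
    factor 3 in the exponent. The extra 1 makes every t \<ge> T a successor, as
    \<open>gap_decay\<close> requires.\<close>
  define T where "T = nat \<lceil>3 * z * ln z\<rceil> + 1"
  have good: "gap t \<le> \<epsilon> / 2" if "T \<le> t" for t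
  proof -
    obtain t' where t': "t = Suc t'" using \<open>T \<le> t\<close> by (cases t) (auto simp: T_def)
    have "3 * z * ln z \<le> real t" using \<open>T \<le> t\<close> by (simp add: T_def) linarith
    then have "3 * ln z \<le> \<eta> * \<tau> * real t"
      using et by (simp add: z_def field_simps)
    then have "exp (- (\<eta> * \<tau> * real t)) \<le> exp (- (3 * ln z))" by simp
    also have "\<dots> = 1 / z ^ 3"
      using z1 exp_of_nat_mult[of 3 "ln z"] by (simp add: exp_minus inverse_eq_divide)
    finally have "exp (- (\<eta> * \<tau> * real t)) \<le> 1 / z ^ 3" .
    moreover have "(1 - \<eta> * \<tau>) ^ t \<le> exp (- (\<eta> * \<tau>)) ^ t"
      using et1 exp_ge_add_one_self[of "- (\<eta> * \<tau>)"] by (intro power_mono) auto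
    moreover have "exp (- (\<eta> * \<tau>)) ^ t = exp (- (\<eta> * \<tau> * real t))"
      using exp_of_nat_mult[of t "- (\<eta> * \<tau>)"] by (simp add: mult_ac)
    ultimately have pw: "(1 - \<eta> * \<tau>) ^ t \<le> 1 / z ^ 3" by linarith
    have "gap t \<le> (\<tau> + K^2 / \<tau>) * ((1 - \<eta> * \<tau>) ^ t * L / (\<eta> * \<tau>))"
      unfolding t' by (rule gap_decay)
    also have "\<dots> = (1 + (K / \<tau>)^2) * (\<epsilon> / 4 * z * (1 - \<eta> * \<tau>) ^ t)"
      using tau_pos L eps eta(1) unfolding z_def tau by (simp add: field_simps power2_eq_square)
    also have "\<dots> \<le> (1 + (z / 2)^2) * (\<epsilon> / 4 * z * (1 / z ^ 3))"
      using Ktau K tau_pos pw eps z1 et1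
      by (intro mult_mono add_mono power_mono mult_left_mono mult_nonneg_nonneg add_nonneg_nonneg) auto
    also have "\<dots> = \<epsilon> / 4 * (1 / z^2) + \<epsilon> / 16"
      using z1 by (simp add: field_simps power2_eq_square power3_eq_cube)
    also have "\<dots> \<le> \<epsilon> / 4 * 1 + \<epsilon> / 16"
      using z1 eps by (intro add_mono mult_left_mono) (auto simp: field_simps intro: one_le_power)
    also have "\<dots> \<le> \<epsilon> / 2" using eps by simp
    finally show ?thesis .
  qed
  have ln2: "1 / 2 \<le> ln (2::real)"
    using ln_le_minus_one[of "1/2::real"] by (simp add: ln_div)
  have ln4: "ln (4::real) = 2 * ln 2" using ln_realpow[of 2 2] by simp
  have W4: "ln 4 \<le> W" using mn y_pos by (simp add: W_def)
  have W1: "1 \<le> W" using W4 ln4 ln2 by linarith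
  have lnm: "ln (real m) \<le> W" "ln (real n) \<le> W" "ln y \<le> W"
    using mn y_pos by (auto simp: W_def)
  have "ln z = ln 4 + ln L + ln y" using L y_pos by (simp add: zy ln_mult)
  \<comment> \<open>This replaces the doubly logarithmic ln L by ln m + ln n, which is at most 2 *
    W.\<close>
  moreover have "ln L \<le> L - 1" using L by (rule ln_le_minus_one)
  ultimately have "ln z \<le> 4 * W" using lnm W4 unfolding L_def by linarith
  moreover have "0 \<le> ln z" using z1 by simp
  ultimately have lnz: "ln z \<le> 4 * W" "0 \<le> ln z" by auto
  have zW: "z \<le> 8 * y * W"
  proof -
    have "4 * y * L \<le> 4 * y * (2 * W)" using lnm y_pos unfolding L_def by (intro mult_left_mono) auto
    then show ?thesis by (simp add: zy mult_ac)
  qed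
  \<comment> \<open>The ceiling and the shift add at most 2. Since 1 \<le> z \<le> 8 * y * W, this
    is charged to the main term, and 96 + 16 = 112.\<close>
  have "real T \<le> 3 * z * ln z + 2"
    using z1 lnz(2) by (simp add: T_def) linarith
  also have "\<dots> \<le> 3 * (8 * y * W) * (4 * W) + 2 * (8 * y * W) * W"
  proof (intro add_mono)
    show "3 * z * ln z \<le> 3 * (8 * y * W) * (4 * W)"
      using zW lnz y_pos W1 z1 by (intro mult_mono) auto
    have "2 * (8 * y * W) * 1 \<le> 2 * (8 * y * W) * W"
      using y_pos W1 by (intro mult_left_mono) auto
    then show "2 \<le> 2 * (8 * y * W) * W" using zW z1 by linarith
  qed
  finally have T_le: "real T \<le> 112 * (y * W^2)" by (simp add: power2_eq_square algebra_simps)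
  have "real T \<le> soft_O_bound 16128 2 m n y"
  proof -
    have "112 * (y * W^2) \<le> 16128 * (y * W^2)" using y_pos by (intro mult_right_mono) auto
    then show ?thesis using T_le by (simp add: soft_O_bound_def W_def mult.assoc)
  qed
  moreover have "real T \<le> soft_O_bound 16128 2 m n (K / \<epsilon>)" if rate: "1 / \<eta> \<le> 2 * \<tau> + 4 * K"
  proof -
    define x where "x = K / \<epsilon>"
    define V where "V = ln (2 + real m + real n + x)"
    have x: "1 < 12 * x" using False eps by (simp add: x_def field_simps)
    have "2 \<le> real m \<or> 2 \<le> real n"
    proof (rule ccontr)
      assume "\<not> ?thesis"
      then have "m = 1" "n = 1" using mn by auto
      then show False using L by (simp add: L_def)
    qed
    then have "ln 2 \<le> ln (real m) \<or> ln 2 \<le> ln (real n)" by auto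
    moreover have "0 \<le> ln (real m)" "0 \<le> ln (real n)" using mn by auto
    ultimately have L2: "1 / 2 \<le> L" using ln2 unfolding L_def by linarith
    have "y = (1 / \<eta>) / \<epsilon>" by (simp add: y_def)
    also have "\<dots> \<le> (2 * \<tau> + 4 * K) / \<epsilon>" using rate eps by (intro divide_right_mono) auto
    also have "\<dots> = 1 / (2 * L) + 4 * x" using eps L by (simp add: tau x_def field_simps)
    also have "1 / (2 * L) \<le> 1" using L2 L by simp
    \<comment> \<open>x > 1/12 turns 1 + 4 * x into at most 16 * x. Passing from \<open>W\<close> to
      \<open>V\<close> will cost a factor 3 in the logarithm, and 112 * 16 * 9 = 16128.\<close>
    finally have yx: "y \<le> 16 * x" using x by linarith
    have V4: "ln 4 \<le> V" using mn x by (simp add: V_def)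
    have "W \<le> ln (16 * (2 + real m + real n + x))"
      unfolding W_def using yx y_pos mn x by simp
    also have "\<dots> = ln 16 + V"
      unfolding V_def using x by (subst ln_mult) auto
    also have "ln (16::real) = 2 * ln 4" using ln_realpow[of 4 2] by simp
    finally have WV: "W \<le> 3 * V" using V4 by linarith
    have "y * W^2 \<le> 16 * x * (3 * V)^2"
      using yx WV W1 y_pos x by (intro mult_mono power_mono) auto
    then have "112 * (y * W^2) \<le> 16128 * (x * V^2)" by (simp add: power_mult_distrib mult_ac)
    then show ?thesis using T_le unfolding soft_O_bound_def x_def[symmetric] V_def[symmetric] by simp
  qed
  ultimately show ?thesis using good unfolding y_def by blast
qed

subsection \<open>Policies as vectors\<close>

text \<open>Strict positivity is built in because \<open>ln\<close> and \<open>powr\<close> then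
  obey their algebraic laws; multiplicative updates preserve it.\<close>

definition is_policy :: "nat \<Rightarrow> real vec \<Rightarrow> bool" where
  "is_policy n p \<longleftrightarrow> p \<in> carrier_vec n \<and> vec_index p \<in> pos_simplex {..<n}"

definition is_policy_pair :: "nat \<Rightarrow> nat \<Rightarrow> real vec \<times> real vec \<Rightarrow> bool" where
  "is_policy_pair m n \<zeta> \<longleftrightarrow> is_policy m (fst \<zeta>) \<and> is_policy n (snd \<zeta>)"

lemma prob_simplex_iff: "p \<in> prob_simplex n \<longleftrightarrow> p \<in> carrier_vec n \<and> vec_index p \<in> simplex_on {..<n}"
  by (auto simp: prob_simplex_def simplex_on_def)

lemma is_policy_prob_simplex: "is_policy n p \<Longrightarrow> p \<in> prob_simplex n"
  by (simp add: prob_simplex_iff is_policy_def pos_simplex_subset)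

lemma uniform_policy_index: "i < n \<Longrightarrow> vec_index (uniform_policy n) i = 1 / real n"
  by (simp add: uniform_policy_def)

lemma is_policy_uniform: "1 \<le> n \<Longrightarrow> is_policy n (uniform_policy n)"
  by (simp add: is_policy_def pos_simplex_def uniform_policy_def)

lemma mw_update_step:
  assumes "is_policy n p"
  shows "is_policy n (mw_update \<eta> \<tau> p g)"
    and "mw_step {..<n} \<eta> \<tau> (vec_index p) (vec_index g) (vec_index (mw_update \<eta> \<tau> p g))"
proof -
  define w where "w = (\<lambda>i. vec_index p i powr (1 - \<eta> * \<tau>) * exp (\<eta> * vec_index g i))"
  define W where "W = (\<Sum>i<n. w i)"
  have p: "dim_vec p = n" "\<And>i. i < n \<Longrightarrow> 0 < vec_index p i" "(\<Sum>i<n. vec_index p i) = 1"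
    using assms by (auto simp: is_policy_def pos_simplex_def)
  have w: "0 < w i" if "i < n" for i using p(2)[OF that] by (simp add: w_def)
  have "n \<noteq> 0" using p(3) by (cases n) auto
  then have W: "0 < W" unfolding W_def using w by (intro sum_pos) auto
  have idx: "vec_index (mw_update \<eta> \<tau> p g) i = w i / W" if "i < n" for i
    using that by (simp add: mw_update_def normalize_vec_def p(1) w_def W_def)
  have dim: "mw_update \<eta> \<tau> p g \<in> carrier_vec n"
    by (rule carrier_vecI) (simp add: mw_update_def normalize_vec_def p(1))
  have pos: "vec_index (mw_update \<eta> \<tau> p g) \<in> pos_simplex {..<n}"
    using w W by (auto simp: pos_simplex_def idx W_def simp flip: sum_divide_distrib)
  then show "is_policy n (mw_update \<eta> \<tau> p g)" using dim by (simp add: is_policy_def)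
  have "ln (vec_index (mw_update \<eta> \<tau> p g) i) = (1 - \<eta> * \<tau>) * ln (vec_index p i) + \<eta> * vec_index g i + (- ln W)"
    if "i < n" for i
    using w[OF that] W p(2)[OF that] by (simp add: idx[OF that] ln_div) (simp add: w_def ln_mult ln_powr)
  then show "mw_step {..<n} \<eta> \<tau> (vec_index p) (vec_index g) (vec_index (mw_update \<eta> \<tau> p g))"
    using pos unfolding mw_step_def by blast
qed

lemma is_policy_pair_update:
  "is_policy_pair m n \<zeta> \<Longrightarrow> is_policy_pair m n (policy_update A \<eta> \<tau> \<zeta> \<xi>)"
  by (auto simp: is_policy_pair_def policy_update_def split_beta intro: mw_update_step)

lemma is_policy_pair_initial:
  "1 \<le> m \<Longrightarrow> 1 \<le> n \<Longrightarrow> A \<in> carrier_mat m n \<Longrightarrow> is_policy_pair m n (initial_policies A)"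
  by (auto simp: is_policy_pair_def initial_policies_def intro: is_policy_uniform)

section \<open>Recursion equations and positivity of the iterates\<close>

lemma pu_iter_Suc:
  "snd (pu_iter A \<eta> \<tau> (Suc t)) = policy_update A \<eta> \<tau> (fst (pu_iter A \<eta> \<tau> t)) (fst (pu_iter A \<eta> \<tau> t))"
  "fst (pu_iter A \<eta> \<tau> (Suc t)) = policy_update A \<eta> \<tau> (fst (pu_iter A \<eta> \<tau> t)) (snd (pu_iter A \<eta> \<tau> (Suc t)))"
  by (simp_all add: split_beta Let_def)

lemma omwu_iter_Suc:
  "snd (omwu_iter A \<eta> \<tau> (Suc t)) = policy_update A \<eta> \<tau> (fst (omwu_iter A \<eta> \<tau> t)) (snd (omwu_iter A \<eta> \<tau> t))"
  "fst (omwu_iter A \<eta> \<tau> (Suc t)) = policy_update A \<eta> \<tau> (fst (omwu_iter A \<eta> \<tau> t)) (snd (omwu_iter A \<eta> \<tau> (Suc t)))"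
  by (simp_all add: split_beta Let_def)

lemma pu_iter_0: "fst (pu_iter A \<eta> \<tau> 0) = initial_policies A" "snd (pu_iter A \<eta> \<tau> 0) = initial_policies A"
  by simp_all

lemma omwu_iter_0: "fst (omwu_iter A \<eta> \<tau> 0) = initial_policies A" "snd (omwu_iter A \<eta> \<tau> 0) = initial_policies A"
  by simp_all

lemma is_policy_pair_pu:
  assumes "1 \<le> m" "1 \<le> n" "A \<in> carrier_mat m n"
  shows "is_policy_pair m n (fst (pu_iter A \<eta> \<tau> t)) \<and> is_policy_pair m n (snd (pu_iter A \<eta> \<tau> t))"
proof (induction t)
  case 0
  show ?case unfolding pu_iter_0 using is_policy_pair_initial[OF assms] by simp
next
  case (Suc t)
  then show ?case unfolding pu_iter_Suc by (simp add: is_policy_pair_update)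
qed

lemma is_policy_pair_omwu:
  assumes "1 \<le> m" "1 \<le> n" "A \<in> carrier_mat m n"
  shows "is_policy_pair m n (fst (omwu_iter A \<eta> \<tau> t)) \<and> is_policy_pair m n (snd (omwu_iter A \<eta> \<tau> t))"
proof (induction t)
  case 0
  show ?case unfolding omwu_iter_0 using is_policy_pair_initial[OF assms] by simp
next
  case (Suc t)
  then show ?case unfolding omwu_iter_Suc by (simp add: is_policy_pair_update)
qed

text \<open>It suffices to bound the gap for every fixed pair of comparison policies, which is the
  form of the estimates for \<open>reg_game\<close> and \<open>bil\<close>.\<close>

lemma SUP_minus_INF_le:
  fixes f :: "'a \<Rightarrow> real" and g :: "'b \<Rightarrow> real"
  assumes "P \<noteq> {}" "Q \<noteq> {}" "\<And>p q. p \<in> P \<Longrightarrow> q \<in> Q \<Longrightarrow> f p - g q \<le> B"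
  shows "(SUP p\<in>P. f p) - (INF q\<in>Q. g q) \<le> B"
proof -
  have "(SUP p\<in>P. f p) \<le> B + g q" if "q \<in> Q" for q
  proof (rule cSUP_least[OF assms(1)])
    fix p assume "p \<in> P"
    then show "f p \<le> B + g q" using assms(3)[OF _ that, of p] by linarith
  qed
  then have "(SUP p\<in>P. f p) - B \<le> g q" if "q \<in> Q" for q
    using that by fastforce
  then have "(SUP p\<in>P. f p) - B \<le> (INF q\<in>Q. g q)"
    by (rule cINF_greatest[OF assms(2)])
  then show ?thesis by linarith
qed

lemma gaps_le:
  assumes "1 \<le> m" "1 \<le> n" "A \<in> carrier_mat m n"
  shows "(\<And>p q. p \<in> prob_simplex m \<Longrightarrow> q \<in> prob_simplex n \<Longrightarrow>
      reg_payoff A \<tau> p (snd \<zeta>) - reg_payoff A \<tau> (fst \<zeta>) q \<le> B) \<Longrightarrow> reg_dual_gap A \<tau> \<zeta> \<le> B"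
    and "(\<And>p q. p \<in> prob_simplex m \<Longrightarrow> q \<in> prob_simplex n \<Longrightarrow>
      payoff A p (snd \<zeta>) - payoff A (fst \<zeta>) q \<le> B) \<Longrightarrow> dual_gap A \<zeta> \<le> B"
proof -
  have ne: "prob_simplex m \<noteq> {}" "prob_simplex n \<noteq> {}"
    using is_policy_uniform[THEN is_policy_prob_simplex] assms(1,2) by blast+
  have d: "dim_row A = m" "dim_col A = n" using assms(3) by auto
  show "reg_dual_gap A \<tau> \<zeta> \<le> B" if "\<And>p q. p \<in> prob_simplex m \<Longrightarrow> q \<in> prob_simplex n \<Longrightarrow>
      reg_payoff A \<tau> p (snd \<zeta>) - reg_payoff A \<tau> (fst \<zeta>) q \<le> B"
    unfolding reg_dual_gap_def split_beta d by (rule SUP_minus_INF_le[OF ne that])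
  show "dual_gap A \<zeta> \<le> B" if "\<And>p q. p \<in> prob_simplex m \<Longrightarrow> q \<in> prob_simplex n \<Longrightarrow>
      payoff A p (snd \<zeta>) - payoff A (fst \<zeta>) q \<le> B"
    unfolding dual_gap_def split_beta d by (rule SUP_minus_INF_le[OF ne that])
qed

text \<open>Each simplex is a single point, so every comparison policy equals the played one; this
  holds for any \<tau>, including the quotient by 0 that arises here.\<close>

lemma gaps_singleton:
  assumes A: "A \<in> carrier_mat 1 1" and z: "is_policy_pair 1 1 \<zeta>"
  shows "reg_dual_gap A \<tau> \<zeta> \<le> 0" "dual_gap A \<zeta> \<le> 0"
proof -
  have eq: "p = q" if "p \<in> prob_simplex 1" "q \<in> prob_simplex 1" for p q
    using that by (intro eq_vecI) (auto simp: prob_simplex_def)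
  have s: "fst \<zeta> \<in> prob_simplex 1" "snd \<zeta> \<in> prob_simplex 1"
    using z by (auto simp: is_policy_pair_def is_policy_prob_simplex)
  show "reg_dual_gap A \<tau> \<zeta> \<le> 0"
  proof (rule gaps_le(1)[OF _ _ A])
    fix p q assume "p \<in> prob_simplex 1" "q \<in> prob_simplex 1"
    then show "reg_payoff A \<tau> p (snd \<zeta>) - reg_payoff A \<tau> (fst \<zeta>) q \<le> 0"
      using eq[of p "fst \<zeta>"] eq[of q "snd \<zeta>"] s by simp
  qed simp_all
  show "dual_gap A \<zeta> \<le> 0"
  proof (rule gaps_le(2)[OF _ _ A])
    fix p q assume "p \<in> prob_simplex 1" "q \<in> prob_simplex 1"
    then show "payoff A p (snd \<zeta>) - payoff A (fst \<zeta>) q \<le> 0"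
      using eq[of p "fst \<zeta>"] eq[of q "snd \<zeta>"] s by simp
  qed simp_all
qed

lemma abs_index_le_max_norm:
  assumes "A \<in> carrier_mat m n" "i < m" "j < n"
  shows "\<bar>A $$ (i, j)\<bar> \<le> max_norm A"
proof -
  have "A $$ (i, j) \<in> elements_mat A" using assms by (intro elements_matI) auto
  moreover have "finite (elements_mat A)" by (simp add: elements_mat_def)
  ultimately show ?thesis by (auto simp: max_norm_def intro: Max_ge)
qed

lemma mw_step_cong:
  assumes "mw_step I \<eta> \<tau> p g q" "\<And>i. i \<in> I \<Longrightarrow> g i = h i"
  shows "mw_step I \<eta> \<tau> p h q"
  using assms unfolding mw_step_def by auto

section \<open>Both iterations as instances of the abstract game\<close>

locale vector_game =
  fixes m n :: nat and A :: "real mat" and \<tau> :: real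
  assumes m_ge: "1 \<le> m" and n_ge: "1 \<le> n" and A_carrier: "A \<in> carrier_mat m n" and tau_gt_0: "0 < \<tau>"

sublocale vector_game \<subseteq> matrix_game "{..<m}" "{..<n}" "\<lambda>i j. A $$ (i, j)" "max_norm A" \<tau>
proof
  show "{..<m} \<noteq> {}" "{..<n} \<noteq> {}" using m_ge n_ge by (auto simp: lessThan_empty_iff)
  show "\<bar>A $$ (i, j)\<bar> \<le> max_norm A" if "i \<in> {..<m}" "j \<in> {..<n}" for i j
    using abs_index_le_max_norm[OF A_carrier] that by simp
qed (use tau_gt_0 in simp_all)

context vector_game
begin

abbreviation row_policy :: "real vec \<times> real vec \<Rightarrow> nat \<Rightarrow> real" where
  "row_policy \<zeta> \<equiv> vec_index (fst \<zeta>)"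

abbreviation col_policy :: "real vec \<times> real vec \<Rightarrow> nat \<Rightarrow> real" where
  "col_policy \<zeta> \<equiv> vec_index (snd \<zeta>)"

lemma mult_mat_vec_index: "v \<in> carrier_vec n \<Longrightarrow> i < m \<Longrightarrow> vec_index (A *\<^sub>v v) i = gain (vec_index v) i"
  using A_carrier by (simp add: gain_def scalar_prod_def atLeast0LessThan)

lemma transpose_mult_vec_index:
  "v \<in> carrier_vec m \<Longrightarrow> j < n \<Longrightarrow> vec_index (- (transpose_mat A *\<^sub>v v)) j = cost (vec_index v) j"
  using A_carrier by (simp add: cost_def scalar_prod_def atLeast0LessThan)

lemma payoff_eq_bil: "v \<in> carrier_vec n \<Longrightarrow> payoff A u v = bil (vec_index u) (vec_index v)"
  using A_carrier
  by (simp add: payoff_def scalar_prod_def atLeast0LessThan bil_def sum_distrib_left mult.assoc)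

lemma reg_payoff_eq_reg_game:
  "u \<in> carrier_vec m \<Longrightarrow> v \<in> carrier_vec n \<Longrightarrow> reg_payoff A \<tau> u v = reg_game (vec_index u) (vec_index v)"
  by (simp add: reg_payoff_def payoff_eq_bil reg_game_def entropy_def)

lemma pair_pos:
  assumes "is_policy_pair m n \<zeta>"
  shows "row_policy \<zeta> \<in> pos_simplex {..<m}" "col_policy \<zeta> \<in> pos_simplex {..<n}"
    "fst \<zeta> \<in> carrier_vec m" "snd \<zeta> \<in> carrier_vec n"
  using assms by (auto simp: is_policy_pair_def is_policy_def)

lemma policy_update_steps:
  assumes "is_policy_pair m n \<zeta>" "is_policy_pair m n \<xi>"
  shows "mw_step {..<m} \<eta> \<tau> (row_policy \<zeta>) (gain (col_policy \<xi>)) (row_policy (policy_update A \<eta> \<tau> \<zeta> \<xi>))"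
    and "mw_step {..<n} \<eta> \<tau> (col_policy \<zeta>) (cost (row_policy \<xi>)) (col_policy (policy_update A \<eta> \<tau> \<zeta> \<xi>))"
proof -
  have z: "is_policy m (fst \<zeta>)" "is_policy n (snd \<zeta>)" using assms(1) by (auto simp: is_policy_pair_def)
  show "mw_step {..<m} \<eta> \<tau> (row_policy \<zeta>) (gain (col_policy \<xi>)) (row_policy (policy_update A \<eta> \<tau> \<zeta> \<xi>))"
    using mw_update_step(2)[OF z(1), of \<eta> \<tau> "A *\<^sub>v snd \<xi>"] mult_mat_vec_index pair_pos(4)[OF assms(2)]
    by (auto simp: policy_update_def split_beta intro: mw_step_cong)
  show "mw_step {..<n} \<eta> \<tau> (col_policy \<zeta>) (cost (row_policy \<xi>)) (col_policy (policy_update A \<eta> \<tau> \<zeta> \<xi>))"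
    using mw_update_step(2)[OF z(2), of \<eta> \<tau> "- (transpose_mat A *\<^sub>v fst \<xi>)"]
      transpose_mult_vec_index pair_pos(3)[OF assms(2)]
    by (auto simp: policy_update_def split_beta intro: mw_step_cong)
qed

definition small_spread :: "real vec \<times> real vec \<Rightarrow> bool" where
  "small_spread \<zeta> \<longleftrightarrow>
     (\<forall>i<m. \<forall>j<m. ln (row_policy \<zeta> i) - ln (row_policy \<zeta> j) \<le> 2 * max_norm A / \<tau>) \<and>
     (\<forall>i<n. \<forall>j<n. ln (col_policy \<zeta> i) - ln (col_policy \<zeta> j) \<le> 2 * max_norm A / \<tau>)"

text \<open>The pair \<xi> supplying the payoffs is arbitrary, so one lemma serves the extrapolation
  and the actual step of both methods.\<close>

lemma small_spread_update:
  assumes pairs: "is_policy_pair m n \<zeta>" "is_policy_pair m n \<xi>" and sp: "small_spread \<zeta>"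
    and eta: "0 \<le> \<eta>" "\<eta> * \<tau> \<le> 1"
  shows "small_spread (policy_update A \<eta> \<tau> \<zeta> \<xi>)"
proof -
  note pos = pair_pos(1,2)[OF pairs(2), THEN pos_simplex_subset]
  show ?thesis unfolding small_spread_def
  proof (intro conjI allI impI)
    fix i j assume "i < m" "j < m"
    then show "ln (row_policy (policy_update A \<eta> \<tau> \<zeta> \<xi>) i) - ln (row_policy (policy_update A \<eta> \<tau> \<zeta> \<xi>) j)
      \<le> 2 * max_norm A / \<tau>"
      using sp abs_gain_le[OF pos(2)] unfolding small_spread_def
      by (intro mw_step_spread[OF policy_update_steps(1)[OF pairs] eta tau_gt_0]) auto
  next
    fix i j assume "i < n" "j < n"
    then show "ln (col_policy (policy_update A \<eta> \<tau> \<zeta> \<xi>) i) - ln (col_policy (policy_update A \<eta> \<tau> \<zeta> \<xi>) j)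
      \<le> 2 * max_norm A / \<tau>"
      using sp abs_cost_le[OF pos(1)] unfolding small_spread_def
      by (intro mw_step_spread[OF policy_update_steps(2)[OF pairs] eta tau_gt_0]) auto
  qed
qed

lemma initial_policies_index:
  "i < m \<Longrightarrow> row_policy (initial_policies A) i = 1 / real m"
  "j < n \<Longrightarrow> col_policy (initial_policies A) j = 1 / real n"
  using A_carrier by (auto simp: initial_policies_def uniform_policy_index)

lemma small_spread_initial: "small_spread (initial_policies A)"
  using K_nonneg tau_gt_0 by (auto simp: small_spread_def initial_policies_index)

lemma KL_pair_initial:
  assumes "equilibrium x y"
  shows "KL_pair x y (row_policy (initial_policies A)) (col_policy (initial_policies A)) \<le> ln (real m) + ln (real n)"
  using KL_pair_uniform[of x y] assms
  by (simp add: equilibrium_def pos_simplex_subset initial_policies_index)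

lemma pu_iter_pairs: "is_policy_pair m n (fst (pu_iter A \<eta> \<tau> t))" "is_policy_pair m n (snd (pu_iter A \<eta> \<tau> t))"
  using is_policy_pair_pu[OF m_ge n_ge A_carrier] by blast+

lemma omwu_iter_pairs: "is_policy_pair m n (fst (omwu_iter A \<eta> \<tau> t))" "is_policy_pair m n (snd (omwu_iter A \<eta> \<tau> t))"
  using is_policy_pair_omwu[OF m_ge n_ge A_carrier] by blast+

lemma small_spread_pu:
  assumes "0 \<le> \<eta>" "\<eta> * \<tau> \<le> 1"
  shows "small_spread (fst (pu_iter A \<eta> \<tau> t)) \<and> small_spread (snd (pu_iter A \<eta> \<tau> t))"
proof (induction t)
  case 0
  show ?case unfolding pu_iter_0 using small_spread_initial by simp
next
  case (Suc t)
  have "small_spread (snd (pu_iter A \<eta> \<tau> (Suc t)))"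
    unfolding pu_iter_Suc(1) using Suc assms by (intro small_spread_update pu_iter_pairs) auto
  moreover have "small_spread (fst (pu_iter A \<eta> \<tau> (Suc t)))"
    unfolding pu_iter_Suc(2) using Suc assms by (intro small_spread_update pu_iter_pairs) auto
  ultimately show ?case by blast
qed

lemma small_spread_omwu:
  assumes "0 \<le> \<eta>" "\<eta> * \<tau> \<le> 1"
  shows "small_spread (fst (omwu_iter A \<eta> \<tau> t)) \<and> small_spread (snd (omwu_iter A \<eta> \<tau> t))"
proof (induction t)
  case 0
  show ?case unfolding omwu_iter_0 using small_spread_initial by simp
next
  case (Suc t)
  have "small_spread (snd (omwu_iter A \<eta> \<tau> (Suc t)))"
    unfolding omwu_iter_Suc(1) using Suc assms by (intro small_spread_update omwu_iter_pairs) auto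
  moreover have "small_spread (fst (omwu_iter A \<eta> \<tau> (Suc t)))"
    unfolding omwu_iter_Suc(2) using Suc assms by (intro small_spread_update omwu_iter_pairs) auto
  ultimately show ?case by blast
qed

lemma pu_decay:
  assumes eq: "equilibrium x y" and eta: "0 < \<eta>" "\<eta> * (\<tau> + 2 * max_norm A) \<le> 1"
  defines "\<zeta> \<equiv> \<lambda>t. snd (pu_iter A \<eta> \<tau> t)"
  shows "\<eta> * \<tau> * KL_pair (row_policy (\<zeta> (Suc t))) (col_policy (\<zeta> (Suc t))) x y
    \<le> (1 - \<eta> * \<tau>) ^ Suc t * (ln (real m) + ln (real n))"
proof -
  define \<xi> where "\<xi> = (\<lambda>t. fst (pu_iter A \<eta> \<tau> t))"
  have pairs: "is_policy_pair m n (\<zeta> t)" "is_policy_pair m n (\<xi> t)" for t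
    unfolding \<zeta>_def \<xi>_def by (rule pu_iter_pairs)+
  have upd: "\<zeta> (Suc t) = policy_update A \<eta> \<tau> (\<xi> t) (\<xi> t)"
    "\<xi> (Suc t) = policy_update A \<eta> \<tau> (\<xi> t) (\<zeta> (Suc t))" for t
    unfolding \<zeta>_def \<xi>_def by (rule pu_iter_Suc)+
  note pos = pair_pos(1,2)[OF pairs(1)] pair_pos(1,2)[OF pairs(2)]
  have xy: "x \<in> pos_simplex {..<m}" "y \<in> pos_simplex {..<n}" using eq by (auto simp: equilibrium_def)
  have "\<eta> * \<tau> + 2 * (\<eta> * max_norm A) \<le> 1" "0 \<le> \<eta> * max_norm A"
    using eta K_nonneg by (auto simp: algebra_simps)
  then have et1: "\<eta> * \<tau> \<le> 1" by linarith
  show ?thesis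
  proof (rule lyapunov_decay[where V = "\<lambda>t. KL_pair x y (row_policy (\<xi> t)) (col_policy (\<xi> t))"
      and D = "\<lambda>t. KL_pair (row_policy (\<zeta> t)) (col_policy (\<zeta> t)) x y"])
    fix t
    note s = policy_update_steps[where \<eta> = \<eta>, OF pairs(2)[of t] pairs(2)[of t], folded upd]
      policy_update_steps[where \<eta> = \<eta>, OF pairs(2)[of t] pairs(1)[of "Suc t"], folded upd]
    show "KL_pair x y (row_policy (\<xi> (Suc t))) (col_policy (\<xi> (Suc t)))
      + \<eta> * \<tau> * KL_pair (row_policy (\<zeta> (Suc t))) (col_policy (\<zeta> (Suc t))) x y
      \<le> (1 - \<eta> * \<tau>) * KL_pair x y (row_policy (\<xi> t)) (col_policy (\<xi> t))"
      by (rule pu_contraction[OF eq pos(3,4) s eta])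
  next
    show "KL_pair x y (row_policy (\<xi> 0)) (col_policy (\<xi> 0)) \<le> ln (real m) + ln (real n)"
      using KL_pair_initial[OF eq] by (simp add: \<xi>_def)
  qed (use eta tau_gt_0 et1 xy pos in \<open>auto intro!: KL_pair_nonneg pos_simplex_subset\<close>)
qed

lemma omwu_decay:
  assumes eq: "equilibrium x y"
    and eta: "0 < \<eta>" "\<eta> * (2 * \<tau> + 2 * max_norm A) \<le> 1" "\<eta> * (4 * max_norm A) \<le> 1"
  defines "\<zeta> \<equiv> \<lambda>t. snd (omwu_iter A \<eta> \<tau> t)"
  shows "\<eta> * \<tau> * KL_pair (row_policy (\<zeta> (Suc t))) (col_policy (\<zeta> (Suc t))) x y
    \<le> (1 - \<eta> * \<tau>) ^ Suc t * (ln (real m) + ln (real n))"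
proof -
  define \<xi> where "\<xi> = (\<lambda>t. fst (omwu_iter A \<eta> \<tau> t))"
  have pairs: "is_policy_pair m n (\<zeta> t)" "is_policy_pair m n (\<xi> t)" for t
    unfolding \<zeta>_def \<xi>_def by (rule omwu_iter_pairs)+
  have upd: "\<zeta> (Suc t) = policy_update A \<eta> \<tau> (\<xi> t) (\<zeta> t)"
    "\<xi> (Suc t) = policy_update A \<eta> \<tau> (\<xi> t) (\<zeta> (Suc t))" for t
    unfolding \<zeta>_def \<xi>_def by (rule omwu_iter_Suc)+
  note pos = pair_pos(1,2)[OF pairs(1)] pair_pos(1,2)[OF pairs(2)]
  have xy: "x \<in> pos_simplex {..<m}" "y \<in> pos_simplex {..<n}" using eq by (auto simp: equilibrium_def)
  have k: "2 * (\<eta> * \<tau>) + 2 * (\<eta> * max_norm A) \<le> 1" "0 \<le> \<eta> * max_norm A" "4 * (\<eta> * max_norm A) \<le> 1"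
    using eta K_nonneg by (auto simp: algebra_simps)
  have "0 < \<eta> * \<tau>" using eta(1) tau_gt_0 by simp
  with k have et1: "\<eta> * \<tau> \<le> 1" by linarith
  have k2: "0 \<le> 1 - 2 * (\<eta> * max_norm A)" using k by linarith
  show ?thesis
  proof (rule lyapunov_decay[where V = "\<lambda>t. KL_pair x y (row_policy (\<xi> t)) (col_policy (\<xi> t))
        + (1 - 2 * (\<eta> * max_norm A)) * KL_pair (row_policy (\<xi> t)) (col_policy (\<xi> t)) (row_policy (\<zeta> t)) (col_policy (\<zeta> t))"
      and D = "\<lambda>t. KL_pair (row_policy (\<zeta> t)) (col_policy (\<zeta> t)) x y"])
    fix t
    note s = policy_update_steps[where \<eta> = \<eta>, OF pairs(2)[of t] pairs(1)[of t], folded upd]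
      policy_update_steps[where \<eta> = \<eta>, OF pairs(2)[of t] pairs(1)[of "Suc t"], folded upd]
    show "KL_pair x y (row_policy (\<xi> (Suc t))) (col_policy (\<xi> (Suc t)))
      + (1 - 2 * (\<eta> * max_norm A)) * KL_pair (row_policy (\<xi> (Suc t))) (col_policy (\<xi> (Suc t)))
          (row_policy (\<zeta> (Suc t))) (col_policy (\<zeta> (Suc t)))
      + \<eta> * \<tau> * KL_pair (row_policy (\<zeta> (Suc t))) (col_policy (\<zeta> (Suc t))) x y
      \<le> (1 - \<eta> * \<tau>) * (KL_pair x y (row_policy (\<xi> t)) (col_policy (\<xi> t))
        + (1 - 2 * (\<eta> * max_norm A)) * KL_pair (row_policy (\<xi> t)) (col_policy (\<xi> t)) (row_policy (\<zeta> t)) (col_policy (\<zeta> t)))"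
      by (rule omwu_contraction[OF eq pos(3,4) pos(1,2) s eta])
  next
    fix t
    show "0 \<le> KL_pair x y (row_policy (\<xi> t)) (col_policy (\<xi> t))
        + (1 - 2 * (\<eta> * max_norm A)) * KL_pair (row_policy (\<xi> t)) (col_policy (\<xi> t)) (row_policy (\<zeta> t)) (col_policy (\<zeta> t))"
      by (intro add_nonneg_nonneg mult_nonneg_nonneg k2 KL_pair_nonneg pos_simplex_subset xy pos)
  next
    \<comment> \<open>Both sequences start at the same pair, so the additional divergence in the
      OMWU potential is 0 at time 0 and the initial bound is the one for PU.\<close>
    have "\<xi> 0 = \<zeta> 0" by (simp add: \<xi>_def \<zeta>_def)
    then show "KL_pair x y (row_policy (\<xi> 0)) (col_policy (\<xi> 0))
        + (1 - 2 * (\<eta> * max_norm A)) * KL_pair (row_policy (\<xi> 0)) (col_policy (\<xi> 0)) (row_policy (\<zeta> 0)) (col_policy (\<zeta> 0))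
      \<le> ln (real m) + ln (real n)"
      using KL_pair_initial[OF eq] by (simp add: KL_pair_def KL_def \<zeta>_def)
  qed (use eta tau_gt_0 et1 xy pos in \<open>auto intro!: KL_pair_nonneg pos_simplex_subset\<close>)
qed

text \<open>The argument common to both methods: an algorithm enters only through positivity, the
  spread bound and the decay of its divergence from every equilibrium.\<close>

lemma last_iterate_gap:
  fixes \<zeta> :: "nat \<Rightarrow> real vec \<times> real vec" and \<epsilon> \<eta> :: real
  defines "L \<equiv> ln (real m) + ln (real n)"
  assumes L: "0 < L" and eps: "0 < \<epsilon>" and tau: "\<tau> = \<epsilon> / 4 / L"
    and eta: "0 < \<eta>" "\<eta> * (\<tau> + 2 * max_norm A) \<le> 1"
    and pairs: "\<And>t. is_policy_pair m n (\<zeta> t)" and spread: "\<And>t. small_spread (\<zeta> t)"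
    and decay: "\<And>x y t. equilibrium x y \<Longrightarrow>
      \<eta> * \<tau> * KL_pair (row_policy (\<zeta> (Suc t))) (col_policy (\<zeta> (Suc t))) x y \<le> (1 - \<eta> * \<tau>) ^ Suc t * L"
  shows "\<exists>T. real T \<le> soft_O_bound 16128 2 m n (1 / (\<eta> * \<epsilon>)) \<and>
     (1 / \<eta> \<le> 2 * \<tau> + 4 * max_norm A \<longrightarrow> real T \<le> soft_O_bound 16128 2 m n (max_norm A / \<epsilon>)) \<and>
     (\<forall>t\<ge>T. reg_dual_gap A \<tau> (\<zeta> t) \<le> \<epsilon> / 2 \<and> dual_gap A (\<zeta> t) \<le> \<epsilon>)"
proof -
  obtain xs ys where eq: "equilibrium xs ys" using equilibrium_exists by blast
  define bound where "bound = (\<lambda>t. (\<tau> + (max_norm A)^2 / \<tau>) * ((1 - \<eta> * \<tau>) ^ t * L / (\<eta> * \<tau>)))"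
  \<comment> \<open>At time 0 only the spread bound is available, because \<open>decay\<close>
    speaks of successors; later the smaller of the two bounds is taken.\<close>
  define gap where "gap = (\<lambda>t. if t = 0 then 6 * max_norm A else min (6 * max_norm A) (bound t))"
  have "\<exists>T. real T \<le> soft_O_bound 16128 2 m n (1 / (\<eta> * \<epsilon>)) \<and>
     (1 / \<eta> \<le> 2 * \<tau> + 4 * max_norm A \<longrightarrow> real T \<le> soft_O_bound 16128 2 m n (max_norm A / \<epsilon>)) \<and>
     (\<forall>t\<ge>T. gap t \<le> \<epsilon> / 2)"
  proof (rule iteration_count[OF m_ge n_ge _ eps _ K_nonneg eta])
    show "0 < ln (real m) + ln (real n)" "\<tau> = \<epsilon> / 4 / (ln (real m) + ln (real n))"
      using L tau by (simp_all add: L_def)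
    show "gap t \<le> 6 * max_norm A" for t by (simp add: gap_def)
    show "gap (Suc t) \<le> (\<tau> + (max_norm A)^2 / \<tau>) *
      ((1 - \<eta> * \<tau>) ^ Suc t * (ln (real m) + ln (real n)) / (\<eta> * \<tau>))" for t
      unfolding gap_def bound_def L_def by simp
  qed
  then obtain T where T: "real T \<le> soft_O_bound 16128 2 m n (1 / (\<eta> * \<epsilon>))"
    "1 / \<eta> \<le> 2 * \<tau> + 4 * max_norm A \<longrightarrow> real T \<le> soft_O_bound 16128 2 m n (max_norm A / \<epsilon>)"
    "\<And>t. T \<le> t \<Longrightarrow> gap t \<le> \<epsilon> / 2" by blast
  have reg: "reg_game p (col_policy (\<zeta> t)) - reg_game (row_policy (\<zeta> t)) q \<le> gap t"
    if "p \<in> simplex_on {..<m}" "q \<in> simplex_on {..<n}" for p q t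
  proof -
    note pos = pair_pos(1,2)[OF pairs[of t]]
    have s: "reg_game p (col_policy (\<zeta> t)) - reg_game (row_policy (\<zeta> t)) q \<le> 6 * max_norm A"
      using spread[of t] unfolding small_spread_def
      by (intro reg_gap_le_spread pos that) auto
    have "reg_game p (col_policy (\<zeta> t)) - reg_game (row_policy (\<zeta> t)) q \<le> bound t" if t: "t \<noteq> 0"
    proof -
      obtain t' where t': "t = Suc t'" using t by (cases t) auto
      have "KL_pair (row_policy (\<zeta> t)) (col_policy (\<zeta> t)) xs ys \<le> (1 - \<eta> * \<tau>) ^ t * L / (\<eta> * \<tau>)"
        using decay[OF eq, of t'] eta(1) tau_gt_0 unfolding t' by (simp add: pos_le_divide_eq mult_ac)
      then have "(\<tau> + (max_norm A)^2 / \<tau>) * KL_pair (row_policy (\<zeta> t)) (col_policy (\<zeta> t)) xs ys \<le> bound t"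
        unfolding bound_def using tau_gt_0 by (intro mult_left_mono) auto
      then show ?thesis
        using reg_gap_le_KL_pair[OF eq pos \<open>p \<in> simplex_on {..<m}\<close> \<open>q \<in> simplex_on {..<n}\<close>] by linarith
    qed
    then show ?thesis using s by (cases "t = 0") (auto simp: gap_def)
  qed
  have "reg_dual_gap A \<tau> (\<zeta> t) \<le> \<epsilon> / 2 \<and> dual_gap A (\<zeta> t) \<le> \<epsilon>" if t: "T \<le> t" for t
  proof
    note pos = pair_pos[OF pairs[of t]]
    show "reg_dual_gap A \<tau> (\<zeta> t) \<le> \<epsilon> / 2"
    proof (rule gaps_le(1)[OF m_ge n_ge A_carrier])
      fix p q assume "p \<in> prob_simplex m" "q \<in> prob_simplex n"
      then show "reg_payoff A \<tau> p (snd (\<zeta> t)) - reg_payoff A \<tau> (fst (\<zeta> t)) q \<le> \<epsilon> / 2"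
        using reg[of "vec_index p" "vec_index q" t] T(3)[OF t] pos
        by (simp add: prob_simplex_iff reg_payoff_eq_reg_game)
    qed
    \<comment> \<open>Removing the entropies costs at most this \<epsilon> / 4, so the unregularized
      gap is at most 3 * \<epsilon> / 4.\<close>
    have tL: "\<tau> * (ln (real m) + ln (real n)) = \<epsilon> / 4" using L unfolding tau L_def[symmetric] by simp
    show "dual_gap A (\<zeta> t) \<le> \<epsilon>"
    proof (rule gaps_le(2)[OF m_ge n_ge A_carrier])
      fix p q assume "p \<in> prob_simplex m" "q \<in> prob_simplex n"
      then have pq: "vec_index p \<in> simplex_on {..<m}" "vec_index q \<in> simplex_on {..<n}" "q \<in> carrier_vec n"
        by (auto simp: prob_simplex_iff)
      have "bil (vec_index p) (col_policy (\<zeta> t)) - bil (row_policy (\<zeta> t)) (vec_index q) \<le> \<epsilon>"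
        using bil_gap_le_reg_gap[OF pos(1,2)[THEN pos_simplex_subset] pq(1,2)] reg[OF pq(1,2), of t] T(3)[OF t] eps tL
        by simp
      then show "payoff A p (snd (\<zeta> t)) - payoff A (fst (\<zeta> t)) q \<le> \<epsilon>"
        using pos pq by (simp add: payoff_eq_bil)
    qed
  qed
  then show ?thesis using T by blast
qed

end

section \<open>The one-action game and the final assembly\<close>

lemma ln_sum_pos:
  assumes "\<not> (m = 1 \<and> n = 1)" "1 \<le> m" "1 \<le> n"
  shows "0 < ln (real m) + ln (real n)"
proof -
  have "1 < m \<or> 1 < n" using assms by auto
  then have "0 < ln (real m) \<or> 0 < ln (real n)" by auto
  moreover have "0 \<le> ln (real m)" "0 \<le> ln (real n)" using assms by auto
  ultimately show ?thesis by linarith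
qed

lemma singleton_case:
  assumes "A \<in> carrier_mat 1 1" "0 < \<epsilon>" "0 < \<eta>" "\<And>t. is_policy_pair 1 1 (\<zeta> t)"
  shows "\<exists>T. real T \<le> soft_O_bound 16128 2 1 1 (1 / (\<eta> * \<epsilon>)) \<and>
     real T \<le> soft_O_bound 16128 2 1 1 (max_norm A / \<epsilon>) \<and>
     (\<forall>t\<ge>T. reg_dual_gap A \<tau> (\<zeta> t) \<le> \<epsilon> / 2 \<and> dual_gap A (\<zeta> t) \<le> \<epsilon>)"
proof -
  have "reg_dual_gap A \<tau> (\<zeta> t) \<le> \<epsilon> / 2 \<and> dual_gap A (\<zeta> t) \<le> \<epsilon>" for t
    using gaps_singleton(1)[OF assms(1) assms(4)[of t], of \<tau>] gaps_singleton(2)[OF assms(1) assms(4)[of t]] assms(2)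
    by linarith
  moreover have "0 \<le> max_norm A"
    using abs_index_le_max_norm[OF assms(1), of 0 0] by simp
  ultimately show ?thesis
    using assms by (intro exI[of _ 0]) (simp add: soft_O_bound_nonneg)
qed

theorem mainTheorem2:
  shows "\<exists>C>0. \<exists>k. \<forall>m n A \<epsilon> \<tau>.
    1 \<le> m \<longrightarrow> 1 \<le> n \<longrightarrow> A \<in> carrier_mat m n \<longrightarrow> 0 < \<epsilon> \<longrightarrow>
    \<tau> = (\<epsilon> / 4) / (ln (real m) + ln (real n)) \<longrightarrow>
      (\<forall>\<eta>. 0 < \<eta> \<and> \<eta> \<le> pu_max_rate A \<tau> \<longrightarrow>
        (\<exists>T. real T \<le> soft_O_bound C k m n (1 / (\<eta> * \<epsilon>)) \<and>
             (\<eta> = pu_max_rate A \<tau> \<longrightarrow> real T \<le> soft_O_bound C k m n (max_norm A / \<epsilon>)) \<and>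
             (\<forall>t\<ge>T. reg_dual_gap A \<tau> (snd (pu_iter A \<eta> \<tau> t)) \<le> \<epsilon> / 2 \<and>
                    dual_gap A (snd (pu_iter A \<eta> \<tau> t)) \<le> \<epsilon>))) \<and>
      (\<forall>\<eta>. 0 < \<eta> \<and> \<eta> \<le> omwu_max_rate A \<tau> \<longrightarrow>
        (\<exists>T. real T \<le> soft_O_bound C k m n (1 / (\<eta> * \<epsilon>)) \<and>
             (\<eta> = omwu_max_rate A \<tau> \<longrightarrow> real T \<le> soft_O_bound C k m n (max_norm A / \<epsilon>)) \<and>
             (\<forall>t\<ge>T. reg_dual_gap A \<tau> (snd (omwu_iter A \<eta> \<tau> t)) \<le> \<epsilon> / 2 \<and>
                    dual_gap A (snd (omwu_iter A \<eta> \<tau> t)) \<le> \<epsilon>)))"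
\<comment> \<open>The constant comes from \<open>iteration_count\<close>. One power of the logarithm
  comes from ln z in its \<open>T\<close>, the other from ln m + ln n inside 1 / \<tau>.\<close>
proof (rule exI[of _ "16128 :: real"], rule conjI, simp, rule exI[of _ "2 :: nat"], intro allI impI conjI)
  fix m n :: nat and A :: "real mat" and \<epsilon> \<tau> \<eta> :: real
  assume mn: "1 \<le> m" "1 \<le> n" and A: "A \<in> carrier_mat m n" and eps: "0 < \<epsilon>"
    and tau: "\<tau> = \<epsilon> / 4 / (ln (real m) + ln (real n))" and eta: "0 < \<eta> \<and> \<eta> \<le> pu_max_rate A \<tau>"
  show "\<exists>T. real T \<le> soft_O_bound 16128 2 m n (1 / (\<eta> * \<epsilon>)) \<and>
     (\<eta> = pu_max_rate A \<tau> \<longrightarrow> real T \<le> soft_O_bound 16128 2 m n (max_norm A / \<epsilon>)) \<and>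
     (\<forall>t\<ge>T. reg_dual_gap A \<tau> (snd (pu_iter A \<eta> \<tau> t)) \<le> \<epsilon> / 2 \<and> dual_gap A (snd (pu_iter A \<eta> \<tau> t)) \<le> \<epsilon>)"
  proof (cases "m = 1 \<and> n = 1")
    case True
    then show ?thesis
      using singleton_case[of A \<epsilon> \<eta> "\<lambda>t. snd (pu_iter A \<eta> \<tau> t)" \<tau>] A eps eta is_policy_pair_pu[OF mn A] by auto
  next
    case False
    then have L: "0 < ln (real m) + ln (real n)" using mn by (rule ln_sum_pos)
    interpret vector_game m n A \<tau>
      using mn A eps L tau by unfold_locales simp_all
    have den: "0 < \<tau> + 2 * max_norm A" using tau_gt_0 K_nonneg by linarith
    have e: "\<eta> * (\<tau> + 2 * max_norm A) \<le> 1"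
      using eta den by (simp add: pu_max_rate_def pos_le_divide_eq)
    have et: "\<eta> * \<tau> \<le> 1" using e eta K_nonneg by (smt (verit) mult_left_mono)
    have rate: "1 / \<eta> \<le> 2 * \<tau> + 4 * max_norm A" if "\<eta> = pu_max_rate A \<tau>"
      using that den by (simp add: pu_max_rate_def)
    have spread: "small_spread (snd (pu_iter A \<eta> \<tau> t))" for t
      using small_spread_pu[of \<eta> t] eta et by simp
    show ?thesis
      using last_iterate_gap[where \<zeta> = "\<lambda>t. snd (pu_iter A \<eta> \<tau> t)" and \<eta> = \<eta>,
          OF L eps tau conjunct1[OF eta] e pu_iter_pairs(2) spread pu_decay[OF _ conjunct1[OF eta] e]] rate
      by blast
  qed
next
  fix m n :: nat and A :: "real mat" and \<epsilon> \<tau> \<eta> :: real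
  assume mn: "1 \<le> m" "1 \<le> n" and A: "A \<in> carrier_mat m n" and eps: "0 < \<epsilon>"
    and tau: "\<tau> = \<epsilon> / 4 / (ln (real m) + ln (real n))" and eta: "0 < \<eta> \<and> \<eta> \<le> omwu_max_rate A \<tau>"
  show "\<exists>T. real T \<le> soft_O_bound 16128 2 m n (1 / (\<eta> * \<epsilon>)) \<and>
     (\<eta> = omwu_max_rate A \<tau> \<longrightarrow> real T \<le> soft_O_bound 16128 2 m n (max_norm A / \<epsilon>)) \<and>
     (\<forall>t\<ge>T. reg_dual_gap A \<tau> (snd (omwu_iter A \<eta> \<tau> t)) \<le> \<epsilon> / 2 \<and> dual_gap A (snd (omwu_iter A \<eta> \<tau> t)) \<le> \<epsilon>)"
  proof (cases "m = 1 \<and> n = 1")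
    case True
    then show ?thesis
      using singleton_case[of A \<epsilon> \<eta> "\<lambda>t. snd (omwu_iter A \<eta> \<tau> t)" \<tau>] A eps eta is_policy_pair_omwu[OF mn A] by auto
  next
    case False
    then have L: "0 < ln (real m) + ln (real n)" using mn by (rule ln_sum_pos)
    interpret vector_game m n A \<tau>
      using mn A eps L tau by unfold_locales simp_all
    have den: "0 < 2 * \<tau> + 2 * max_norm A" using tau_gt_0 K_nonneg by linarith
    have rate_le: "\<eta> \<le> 1 / (2 * \<tau> + 2 * max_norm A)" "max_norm A \<noteq> 0 \<Longrightarrow> \<eta> \<le> 1 / (4 * max_norm A)"
      using eta by (auto simp: omwu_max_rate_def split: if_splits)
    have e: "\<eta> * (2 * \<tau> + 2 * max_norm A) \<le> 1"
      using rate_le(1) den by (simp add: pos_le_divide_eq)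
    \<comment> \<open>For \<open>max_norm A = 0\<close> the quotient 1 / (4 * max_norm A) is 0 in
      HOL and yields no rate condition; the claim is then 0 \<le> 1.\<close>
    have e4: "\<eta> * (4 * max_norm A) \<le> 1"
    proof (cases "max_norm A = 0")
      case False
      then have "0 < 4 * max_norm A" using K_nonneg by simp
      then show ?thesis using rate_le(2)[OF False] by (simp only: pos_le_divide_eq)
    qed simp
    have e': "\<eta> * (\<tau> + 2 * max_norm A) \<le> 1" and et: "\<eta> * \<tau> \<le> 1"
      using e eta K_nonneg tau_gt_0 by (smt (verit) mult_left_mono)+
    have rate: "1 / \<eta> \<le> 2 * \<tau> + 4 * max_norm A" if "\<eta> = omwu_max_rate A \<tau>"
      using that den tau_gt_0 K_nonneg by (auto simp: omwu_max_rate_def min_def)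
    have spread: "small_spread (snd (omwu_iter A \<eta> \<tau> t))" for t
      using small_spread_omwu[of \<eta> t] eta et by simp
    show ?thesis
      using last_iterate_gap[where \<zeta> = "\<lambda>t. snd (omwu_iter A \<eta> \<tau> t)" and \<eta> = \<eta>,
          OF L eps tau conjunct1[OF eta] e' omwu_iter_pairs(2) spread omwu_decay[OF _ conjunct1[OF eta] e e4]] rate
      by blast
  qed
qed

end
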